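(* Let $G$ be a simple connected graph with clique number $\omega(G)=2$. Then $G$ is $\mathcal F_3$-free if and only if $G$ is isomorphic to an induced subgraph of a graph in the family $\mathcal F_2$.
   Context: All graphs are finite. The clique number $\omega(G)$ is the maximum size of a set of mutually adjacent vertices. For a family $\mathcal F$ of graphs, $G$ is $\mathcal F$-free if no induced subgraph of $G$ is isomorphic to a member of $\mathcal F$. Substitution: given a simple graph $H$ and, for each vertex $u$ of $H$, a positive integer $n_u$ and a type (clique or stable set), one forms a new simple graph by replacing each $u$ by a set $V_u$ of $n_u$ vertices, which is a clique or a stable set (no edges inside) according to its type, and, for $u\ne v$, joining every vertex of $V_u$ to every vertex of $V_v$ if $uv\in E(H)$, and to none otherwise. The family $\mathcal F_2$ consists of the following graphs, for arbitrary positive integers $n_1,n_2$: (i) the complete bipartite graphs $K_{n_1,n_2}$; (ii) $\mathcal F_2^1$: the graphs obtained from the path $p_1p_2p_3p_4$ (edges $p_1p_2,p_2p_3,p_3p_4$) by replacing $p_1$ and $p_2$ by stable sets of cardinalities $n_1$ and $n_2$; (iii) $\mathcal F_2^2$: the graphs obtained from the path $p_1p_2p_3p_4$ by replacing the two inner vertices $p_2$ and $p_3$ by stable sets of cardinalities $n_1$ and $n_2$; (iv) $\mathcal F_2^3$: the graphs obtained from the cycle $C_5$ by replacing two adjacent vertices by stable sets of cardinalities $n_1$ and $n_2$. The family $\mathcal F_3$ consists of the 49 graphs listed below. Each is described by an underlying graph, given by its edge list ($ij$ denotes the edge between vertices $i$ and $j$; the vertices are the digits that appear), together with a set $W$ of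 vertices to be replaced by a stable set of cardinality $2$ and a set $B$ of vertices to be replaced by a clique of cardinality $2$ (all other vertices remain single; omitted $W$ or $B$ are empty). $P_5$: 12,23,34,45. $G_{6,1}$: 15,46,56; $W=\{1,4\}$. $G_{6,2}$: 15,16,25,46,56; $W=\{4\}$. $G_{6,3}$: 15,16,46; $W=\{1,4\}$. $G_{6,4}$: 15,16,46,56; $W=\{1,4\}$. $G_{6,5}$: 15,16,35,46,56; $W=\{1\}$. $G_{6,6}$: 16,25,26,36; $B=\{1\}$. $G_{6,7}$: 14,16,25,26,56; $W=\{2\}$. $G_{6,8}$: 14,15,16,25,36,56. $G_{6,9}$: 14,15,16,25,26,36. $G_{6,10}$: 14,15,16,25,26,36,56. $G_{6,11}$: 14,15,16,25,26,36,46. $G_{6,12}$: 14,15,16,25,26,36,46,56. $G_{6,13}$: 15,16,25,26,36,56; $B=\{1\}$. $G_{6,14}$: 14,15,16,25,26,35,46,56. $G_{6,15}$: 14,15,16,25,26,46; $W=\{2\}$. $G_{6,16}$: 14,15,16,25,26,46,56; $W=\{2\}$. $G_{6,17}$: 14,15,16,24,26,35,36,45,46. $G_{6,18}$: 14,15,16,24,26,35,36,45,46,56. $G_{6,19}$: 15,16,25,36,56; $B=\{5\}$. $G_{6,20}$: 15,16,24,25,46,56; $B=\{1\}$. $G_{6,21}$: 13,15,16,24,25,26,35,46. $G_{6,22}$: 13,15,16,24,25,26,35,46,56. $G_{6,23}$: 14,15,16,25,26,46,56; $B=\{1\}$. $G_{6,24}$: 13,14,15,16,24,25,26,35,46,56.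 $G_{6,25}$: 13,14,15,16,24,25,26,35,36,46. $G_{6,26}$: 13,14,15,16,24,25,26,35,36,46,56. $G_{6,27}$: 13,14,15,24,25,35,45; $B=\{5\}$. $G_{7,1}$: 17,27,37; $W=\{3\}$, $B=\{1,2\}$. $G_{7,2}$: 16,17,26,27,47; $W=\{2\}$, $B=\{1\}$. $G_{7,3}$: 24,26,27,37,46,47,67; $W=\{2,4\}$. $G_{7,4}$: 15,16,17,37,56,57; $W=\{1\}$, $B=\{5\}$. $G_{7,5}$: 24,25,26,27,36,37,45,46,47,57; $W=\{2\}$. $G_{7,6}$: 14,16,36,46; $W=\{1\}$, $B=\{4,6\}$. $G_{7,7}$: 14,15,24,25,35; $B=\{1,4\}$. $G_{7,8}$: 24,25,27,35,47,57; $W=\{2\}$, $B=\{4\}$. $G_{7,9}$: 24,25,26,35,36; $W=\{2\}$, $B=\{5\}$. $G_{7,10}$: 14,15,17,35,37,57; $W=\{1,5\}$. $G_{7,11}$: 14,16,17,36,37,46,47; $W=\{1\}$, $B=\{7\}$. $G_{7,12}$: 24,25,27,35,37,45,47,57; $W=\{2,5\}$. $G_{7,13}$: 15,16,17,35,36,57; $W=\{1,5\}$. $G_{7,14}$: 15,17,27; $B=\{2,5,7\}$. $G_{7,15}$: 14,15,17,25,27,47; $B=\{1,7\}$. $G_{7,16}$: 13,14,17,23,24,27,37,47; $B=\{1,3\}$. $G_{7,17}$: 13,14,16,23,24,26,36,46; $B=\{3,6\}$. $G_{8,1}$: 36,37,46,47,56,57; $B=\{4,5,6\}$. $G_{8,2}$: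 16,18,36,38,56,58,68; $W=\{6\}$, $B=\{1,5\}$. $G_{8,3}$: 35,37,45,47; $W=\{3,7\}$, $B=\{4,5\}$. $G_{8,4}$: 13,15,17,35,37,57; $W=\{1,3,5\}$, $B=\{7\}$. *)

theory Defs
  imports "Graph_Theory.Graph_Theory"
begin

text \<open>
  A finite simple graph is a \<^term>\<open>pair_graph\<close>: a finite symmetric loop-free digraph whose arcs are
  pairs of vertices, so that an edge is a pair of opposite arcs.
\<close>

definition clique_number :: "'a pair_pre_digraph \<Rightarrow> nat" where
  "clique_number G =
     Max {card S | S. S \<subseteq> pverts G \<and> (\<forall>u\<in>S. \<forall>v\<in>S. u \<noteq> v \<longrightarrow> (u, v) \<in> parcs G)}"

definition iso_to_induced_subgraph :: "'a pair_pre_digraph \<Rightarrow> 'b pair_pre_digraph \<Rightarrow> bool" where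
  "iso_to_induced_subgraph H G \<longleftrightarrow>
     (\<exists>K. induced_subgraph (with_proj K) (with_proj G) \<and> digraph_iso (with_proj H) (with_proj K))"

definition family_free :: "'b pair_pre_digraph set \<Rightarrow> 'a pair_pre_digraph \<Rightarrow> bool" where
  "family_free F G \<longleftrightarrow> (\<forall>H\<in>F. \<not> iso_to_induced_subgraph H G)"

datatype vertex_type = Clique | Stable

text \<open>
  The set \<open>V\<^sub>u\<close> replacing the vertex \<open>u\<close> is \<open>{u} \<times> {..<n u}\<close>.  This is the substitution construction
  when all the sizes \<open>n u\<close> are positive.
\<close>

definition substitution ::
    "'a pair_pre_digraph \<Rightarrow> ('a \<Rightarrow> nat) \<Rightarrow> ('a \<Rightarrow> vertex_type) \<Rightarrow> ('a \<times> nat) pair_pre_digraph" where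
  "substitution H n t =
     (let V = (SIGMA u:pverts H. {..<n u}) in
      \<lparr>pverts = V,
       parcs = {((u, i), (v, j)) | u i v j. (u, i) \<in> V \<and> (v, j) \<in> V \<and>
         (if u = v then t u = Clique \<and> i \<noteq> j else (u, v) \<in> parcs H)}\<rparr>)"

text \<open>Each edge is listed in one orientation only; there are no isolated vertices.\<close>

definition edge_graph :: "'a rel \<Rightarrow> 'a pair_pre_digraph" where
  "edge_graph E = \<lparr>pverts = Field E, parcs = E \<union> E\<inverse>\<rparr>"

definition P4 :: "nat pair_pre_digraph" where
  "P4 = edge_graph {(1,2), (2,3), (3,4)}"

definition C5 :: "nat pair_pre_digraph" where
  "C5 = edge_graph {(1,2), (2,3), (3,4), (4,5), (5,1)}"

definition stable_substitution :: "'a pair_pre_digraph \<Rightarrow> ('a \<Rightarrow> nat) \<Rightarrow> ('a \<times> nat) pair_pre_digraph" where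
  "stable_substitution H n = substitution H n (\<lambda>_. Stable)"

definition F2_1 :: "(nat \<times> nat) pair_pre_digraph set" where
  "F2_1 = {stable_substitution P4 ((\<lambda>_. 1)(1 := n\<^sub>1, 2 := n\<^sub>2)) | n\<^sub>1 n\<^sub>2. n\<^sub>1 > 0 \<and> n\<^sub>2 > 0}"

definition F2_2 :: "(nat \<times> nat) pair_pre_digraph set" where
  "F2_2 = {stable_substitution P4 ((\<lambda>_. 1)(2 := n\<^sub>1, 3 := n\<^sub>2)) | n\<^sub>1 n\<^sub>2. n\<^sub>1 > 0 \<and> n\<^sub>2 > 0}"

definition F2_3 :: "(nat \<times> nat) pair_pre_digraph set" where
  "F2_3 = {stable_substitution C5 ((\<lambda>_. 1)(1 := n\<^sub>1, 2 := n\<^sub>2)) | n\<^sub>1 n\<^sub>2. n\<^sub>1 > 0 \<and> n\<^sub>2 > 0}"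

text \<open>
  The complete bipartite graphs are all those with vertices in \<^typ>\<open>nat \<times> nat\<close>.  As this type is
  infinite, every isomorphism class of finite graphs has representatives over it.
\<close>

definition F2 :: "(nat \<times> nat) pair_pre_digraph set" where
  "F2 = {H. \<exists>n\<^sub>1 n\<^sub>2. n\<^sub>1 > 0 \<and> n\<^sub>2 > 0 \<and> complete_bipartite_digraph n\<^sub>1 n\<^sub>2 (with_proj H)}
        \<union> F2_1 \<union> F2_2 \<union> F2_3"

definition clone_graph :: "nat rel \<Rightarrow> nat set \<Rightarrow> nat set \<Rightarrow> (nat \<times> nat) pair_pre_digraph" where
  "clone_graph E W B = substitution (edge_graph E)
     (\<lambda>u. if u \<in> W \<union> B then 2 else 1) (\<lambda>u. if u \<in> B then Clique else Stable)"

text \<open>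
  Order of listing: P_5; G_{6,1}, ..., G_{6,27}; G_{7,1}, ..., G_{7,17}; G_{8,1}, ..., G_{8,4}.
\<close>

definition F3 :: "(nat \<times> nat) pair_pre_digraph set" where
  "F3 = {
    clone_graph {(1,2), (2,3), (3,4), (4,5)} {} {},
    clone_graph {(1,5), (4,6), (5,6)} {1, 4} {},
    clone_graph {(1,5), (1,6), (2,5), (4,6), (5,6)} {4} {},
    clone_graph {(1,5), (1,6), (4,6)} {1, 4} {},
    clone_graph {(1,5), (1,6), (4,6), (5,6)} {1, 4} {},
    clone_graph {(1,5), (1,6), (3,5), (4,6), (5,6)} {1} {},
    clone_graph {(1,6), (2,5), (2,6), (3,6)} {} {1},
    clone_graph {(1,4), (1,6), (2,5), (2,6), (5,6)} {2} {},
    clone_graph {(1,4), (1,5), (1,6), (2,5), (3,6), (5,6)} {} {},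
    clone_graph {(1,4), (1,5), (1,6), (2,5), (2,6), (3,6)} {} {},
    clone_graph {(1,4), (1,5), (1,6), (2,5), (2,6), (3,6), (5,6)} {} {},
    clone_graph {(1,4), (1,5), (1,6), (2,5), (2,6), (3,6), (4,6)} {} {},
    clone_graph {(1,4), (1,5), (1,6), (2,5), (2,6), (3,6), (4,6), (5,6)} {} {},
    clone_graph {(1,5), (1,6), (2,5), (2,6), (3,6), (5,6)} {} {1},
    clone_graph {(1,4), (1,5), (1,6), (2,5), (2,6), (3,5), (4,6), (5,6)} {} {},
    clone_graph {(1,4), (1,5), (1,6), (2,5), (2,6), (4,6)} {2} {},
    clone_graph {(1,4), (1,5), (1,6), (2,5), (2,6), (4,6), (5,6)} {2} {},
    clone_graph {(1,4), (1,5), (1,6), (2,4), (2,6), (3,5), (3,6), (4,5), (4,6)} {} {},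
    clone_graph {(1,4), (1,5), (1,6), (2,4), (2,6), (3,5), (3,6), (4,5), (4,6), (5,6)} {} {},
    clone_graph {(1,5), (1,6), (2,5), (3,6), (5,6)} {} {5},
    clone_graph {(1,5), (1,6), (2,4), (2,5), (4,6), (5,6)} {} {1},
    clone_graph {(1,3), (1,5), (1,6), (2,4), (2,5), (2,6), (3,5), (4,6)} {} {},
    clone_graph {(1,3), (1,5), (1,6), (2,4), (2,5), (2,6), (3,5), (4,6), (5,6)} {} {},
    clone_graph {(1,4), (1,5), (1,6), (2,5), (2,6), (4,6), (5,6)} {} {1},
    clone_graph {(1,3), (1,4), (1,5), (1,6), (2,4), (2,5), (2,6), (3,5), (4,6), (5,6)} {} {},
    clone_graph {(1,3), (1,4), (1,5), (1,6), (2,4), (2,5), (2,6), (3,5), (3,6), (4,6)} {} {},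
    clone_graph {(1,3), (1,4), (1,5), (1,6), (2,4), (2,5), (2,6), (3,5), (3,6), (4,6), (5,6)} {} {},
    clone_graph {(1,3), (1,4), (1,5), (2,4), (2,5), (3,5), (4,5)} {} {5},
    clone_graph {(1,7), (2,7), (3,7)} {3} {1, 2},
    clone_graph {(1,6), (1,7), (2,6), (2,7), (4,7)} {2} {1},
    clone_graph {(2,4), (2,6), (2,7), (3,7), (4,6), (4,7), (6,7)} {2, 4} {},
    clone_graph {(1,5), (1,6), (1,7), (3,7), (5,6), (5,7)} {1} {5},
    clone_graph {(2,4), (2,5), (2,6), (2,7), (3,6), (3,7), (4,5), (4,6), (4,7), (5,7)} {2} {},
    clone_graph {(1,4), (1,6), (3,6), (4,6)} {1} {4, 6},
    clone_graph {(1,4), (1,5), (2,4), (2,5), (3,5)} {} {1, 4},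
    clone_graph {(2,4), (2,5), (2,7), (3,5), (4,7), (5,7)} {2} {4},
    clone_graph {(2,4), (2,5), (2,6), (3,5), (3,6)} {2} {5},
    clone_graph {(1,4), (1,5), (1,7), (3,5), (3,7), (5,7)} {1, 5} {},
    clone_graph {(1,4), (1,6), (1,7), (3,6), (3,7), (4,6), (4,7)} {1} {7},
    clone_graph {(2,4), (2,5), (2,7), (3,5), (3,7), (4,5), (4,7), (5,7)} {2, 5} {},
    clone_graph {(1,5), (1,6), (1,7), (3,5), (3,6), (5,7)} {1, 5} {},
    clone_graph {(1,5), (1,7), (2,7)} {} {2, 5, 7},
    clone_graph {(1,4), (1,5), (1,7), (2,5), (2,7), (4,7)} {} {1, 7},
    clone_graph {(1,3), (1,4), (1,7), (2,3), (2,4), (2,7), (3,7), (4,7)} {} {1, 3},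
    clone_graph {(1,3), (1,4), (1,6), (2,3), (2,4), (2,6), (3,6), (4,6)} {} {3, 6},
    clone_graph {(3,6), (3,7), (4,6), (4,7), (5,6), (5,7)} {} {4, 5, 6},
    clone_graph {(1,6), (1,8), (3,6), (3,8), (5,6), (5,8), (6,8)} {6} {1, 5},
    clone_graph {(3,5), (3,7), (4,5), (4,7)} {3, 7} {4, 5},
    clone_graph {(1,3), (1,5), (1,7), (3,5), (3,7), (5,7)} {1, 3, 5} {7}}"

end

theory Submission
  imports Defs
begin

text \<open>
  Every graph in \<open>F2\<close> is an induced subgraph of a \<open>C5\<close> with two adjacent vertices replaced by stable
  sets, so the right-hand side of the theorem says that \<open>G\<close> has a map to \<open>C5\<close> preserving and reflecting
  adjacency, injective over three consecutive vertices.  Such a map excludes triangles, and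
  \<open>P\<^sub>5\<close>, \<open>G\<^bsub>6,1\<^esub>\<close>, \<open>G\<^bsub>6,3\<^esub>\<close>, \<open>G\<^bsub>6,9\<^esub>\<close>, which are the only triangle-free members of \<open>F3\<close>.

  Conversely, suppose that these four graphs are excluded from a connected triangle-free graph.  If there is a
  pentagon, then by \<open>P\<^sub>5\<close>-freeness every vertex is a twin of a pentagon vertex, and \<open>G\<^bsub>6,3\<^esub>\<close> forbids
  two nonadjacent classes with more than one vertex.  Otherwise the graph is bipartite with nested
  neighbourhoods; \<open>G\<^bsub>6,9\<^esub>\<close> forces the missing edges between the two sides to form a complete
  bipartite graph, and \<open>G\<^bsub>6,1\<^esub>\<close> and \<open>G\<^bsub>6,3\<^esub>\<close> bound its sides.
\<close>

section \<open>Maps that preserve and reflect adjacency\<close>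

text \<open>Injectivity is kept separate: with it such a map is an embedding as an induced subgraph,
  without it nonadjacent twins may be merged, which the maps to \<open>C5\<close> rely on.\<close>

definition induced_hom :: "('a \<Rightarrow> 'b) \<Rightarrow> 'a pair_pre_digraph \<Rightarrow> 'b pair_pre_digraph \<Rightarrow> bool" where
  "induced_hom f H G \<longleftrightarrow> f ` pverts H \<subseteq> pverts G \<and>
    (\<forall>u\<in>pverts H. \<forall>v\<in>pverts H. (u, v) \<in> parcs H \<longleftrightarrow> (f u, f v) \<in> parcs G)"

lemma induced_homI:
  assumes "\<And>u. u \<in> pverts H \<Longrightarrow> f u \<in> pverts G"
    and "\<And>u v. u \<in> pverts H \<Longrightarrow> v \<in> pverts H \<Longrightarrow> (u, v) \<in> parcs H \<longleftrightarrow> (f u, f v) \<in> parcs G"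
  shows "induced_hom f H G"
  using assms by (auto simp: induced_hom_def)

lemma induced_hom_verts: "induced_hom f H G \<Longrightarrow> u \<in> pverts H \<Longrightarrow> f u \<in> pverts G"
  by (auto simp: induced_hom_def)

lemma induced_hom_arcs:
  "induced_hom f H G \<Longrightarrow> u \<in> pverts H \<Longrightarrow> v \<in> pverts H \<Longrightarrow>
    (f u, f v) \<in> parcs G \<longleftrightarrow> (u, v) \<in> parcs H"
  by (auto simp: induced_hom_def)

lemma induced_hom_comp: "induced_hom f H G \<Longrightarrow> induced_hom g G K \<Longrightarrow> induced_hom (g \<circ> f) H K"
  by (rule induced_homI) (auto simp: induced_hom_verts induced_hom_arcs)

text \<open>Arcs are pairs of vertices, so a digraph isomorphism is determined by its vertex map,
  and the image is an induced subgraph exactly when adjacency is reflected as well as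
  preserved.\<close>

lemma iso_to_induced_subgraph_iff:
  assumes "pair_wf_digraph H" "pair_wf_digraph G"
  shows "iso_to_induced_subgraph H G \<longleftrightarrow> (\<exists>f. inj_on f (pverts H) \<and> induced_hom f H G)"
    (is "?L \<longleftrightarrow> ?R")
proof -
  interpret H: pair_wf_digraph H by fact
  interpret G: pair_wf_digraph G by fact
  show ?thesis
  proof
    assume ?L
    then obtain K h where K: "induced_subgraph (with_proj K) (with_proj G)"
      and h: "pre_digraph.digraph_isomorphism (with_proj H) h"
      and eq: "with_proj K = app_iso h (with_proj H)"
      unfolding iso_to_induced_subgraph_def digraph_iso_def by blast
    let ?f = "iso_verts h"
    have pv: "pverts K = ?f ` pverts H" and pa: "parcs K = iso_arcs h ` parcs H"
      and tl: "iso_tail h = fst" and hd: "iso_head h = snd"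
      using eq by (auto simp: app_iso_def with_proj_def)
    have inj: "inj_on ?f (pverts H)"
      and arcs: "\<And>e. e \<in> parcs H \<Longrightarrow> iso_arcs h e = (?f (fst e), ?f (snd e))"
      using h tl hd unfolding pre_digraph.digraph_isomorphism_def by (auto simp: prod_eq_iff)
    have ind: "pverts K \<subseteq> pverts G"
      "parcs K = {e \<in> parcs G. fst e \<in> pverts K \<and> snd e \<in> pverts K}"
      using K by (auto simp: induced_subgraph_def subgraph_def)
    have "(u, v) \<in> parcs H \<longleftrightarrow> (?f u, ?f v) \<in> parcs G" if uv: "u \<in> pverts H" "v \<in> pverts H" for u v
    proof
      assume "(u, v) \<in> parcs H"
      then have "(?f u, ?f v) \<in> parcs K" using arcs[of "(u, v)"] pa by force
      then show "(?f u, ?f v) \<in> parcs G" using ind by simp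
    next
      \<comment> \<open>\<open>K\<close> is induced, so this arc is the image of an arc
        \<open>e\<close> of \<open>H\<close>; injectivity identifies the ends of \<open>e\<close>
        with \<open>u\<close> and \<open>v\<close>.\<close>
      assume "(?f u, ?f v) \<in> parcs G"
      then have "(?f u, ?f v) \<in> parcs K" using uv pv by (simp add: ind(2))
      then obtain e where e: "e \<in> parcs H" "(?f u, ?f v) = iso_arcs h e" using pa by auto
      then have "?f u = ?f (fst e)" "?f v = ?f (snd e)" using arcs by auto
      moreover have "fst e \<in> pverts H" "snd e \<in> pverts H"
        using e(1) H.in_arcsD1 H.in_arcsD2 by (metis prod.collapse)+
      ultimately have "u = fst e" "v = snd e" using inj uv by (auto dest: inj_onD)
      then show "(u, v) \<in> parcs H" using e by simp
    qed
    then show ?R using inj pv ind(1) by (intro exI[of _ ?f]) (auto simp: induced_hom_def)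
  next
    assume ?R
    then obtain f where inj: "inj_on f (pverts H)" and im: "f ` pverts H \<subseteq> pverts G"
      and arcs: "\<And>u v. u \<in> pverts H \<Longrightarrow> v \<in> pverts H \<Longrightarrow> (u, v) \<in> parcs H \<longleftrightarrow> (f u, f v) \<in> parcs G"
      by (auto simp: induced_hom_def)
    \<comment> \<open>An isomorphism also carries maps for arcs, heads and tails: arcs move
      componentwise, heads and tails remain the projections.\<close>
    define h where "h = \<lparr>iso_verts = f, iso_arcs = map_prod f f, iso_head = snd, iso_tail = fst\<rparr>"
    define K where "K = \<lparr>pverts = f ` pverts H, parcs = map_prod f f ` parcs H\<rparr>"
    have wf: "fst e \<in> pverts H" "snd e \<in> pverts H" if "e \<in> parcs H" for e
      using that H.wellformed by auto
    have injp: "inj_on (map_prod f f) (parcs H)"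
    proof (rule inj_onI)
      fix d e assume "d \<in> parcs H" "e \<in> parcs H" "map_prod f f d = map_prod f f e"
      then show "d = e"
        using wf[of d] wf[of e] inj by (cases d; cases e) (simp add: inj_on_eq_iff)
    qed
    have Kwf: "pair_wf_digraph K"
      by unfold_locales (use wf in \<open>force simp: K_def\<close>)+
    have "parcs K = {e \<in> parcs G. fst e \<in> pverts K \<and> snd e \<in> pverts K}"
    proof (intro set_eqI iffI)
      fix e assume "e \<in> parcs K"
      then obtain d where "d \<in> parcs H" "e = map_prod f f d" by (auto simp: K_def)
      then show "e \<in> {e \<in> parcs G. fst e \<in> pverts K \<and> snd e \<in> pverts K}"
        using wf[of d] arcs[of "fst d" "snd d"] by (cases d) (simp add: K_def)
    next
      fix e assume e: "e \<in> {e \<in> parcs G. fst e \<in> pverts K \<and> snd e \<in> pverts K}"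
      then obtain u v where "u \<in> pverts H" "v \<in> pverts H" "e = (f u, f v)"
        by (cases e) (auto simp: K_def)
      then show "e \<in> parcs K" using e arcs[of u v] by (auto simp: K_def intro!: rev_image_eqI)
    qed
    moreover have "pverts K \<subseteq> pverts G" using im by (simp add: K_def)
    ultimately have "induced_subgraph (with_proj K) (with_proj G)"
      unfolding induced_subgraph_def subgraph_def
      using Kwf assms(2) by (auto simp: compatible_def wf_digraph_wp_iff)
    moreover have "digraph_iso (with_proj H) (with_proj K)"
      unfolding digraph_iso_def pre_digraph.digraph_isomorphism_def
      using inj injp H.wf_digraph_axioms
      by (intro exI[of _ h]) (auto simp: h_def K_def app_iso_def with_proj_def)
    ultimately show ?L
      unfolding iso_to_induced_subgraph_def by blast
  qed
qed

section \<open>Substitution graphs and their induced subgraphs\<close>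

lemma pair_wf_substitution: "pair_wf_digraph (substitution H n t)"
  by unfold_locales (auto simp: substitution_def Let_def)

lemma pverts_substitution: "pverts (substitution H n t) = (SIGMA u:pverts H. {..<n u})"
  by (simp add: substitution_def Let_def)

lemma parcs_substitution:
  "((u, i), (v, j)) \<in> parcs (substitution H n t) \<longleftrightarrow>
    u \<in> pverts H \<and> i < n u \<and> v \<in> pverts H \<and> j < n v \<and>
    (if u = v then t u = Clique \<and> i \<noteq> j else (u, v) \<in> parcs H)"
  by (auto simp: substitution_def Let_def)

text \<open>The first coordinate of an embedding is \<open>\<phi>\<close>; the second is injective
  on each fibre, which bounds its size. Loop-freeness of \<open>K\<close> makes the fibres stable,
  like the substituted sets.\<close>

lemma iso_to_induced_stable_substitution_iff:
  assumes G: "pair_wf_digraph G" "finite (pverts G)"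
    and loopfree: "\<And>x. (x, x) \<notin> parcs K"
  shows "iso_to_induced_subgraph G (stable_substitution K n) \<longleftrightarrow>
    (\<exists>\<phi>. induced_hom \<phi> G K \<and> (\<forall>x\<in>pverts K. card {v \<in> pverts G. \<phi> v = x} \<le> n x))"
    (is "?L \<longleftrightarrow> ?R")
proof -
  note sub = stable_substitution_def pverts_substitution parcs_substitution
  have iff: "?L \<longleftrightarrow> (\<exists>f. inj_on f (pverts G) \<and> induced_hom f G (stable_substitution K n))"
    by (rule iso_to_induced_subgraph_iff) (simp_all add: G pair_wf_substitution stable_substitution_def)
  show ?thesis
  proof
    assume ?L
    then obtain f where inj: "inj_on f (pverts G)" and f: "induced_hom f G (stable_substitution K n)"
      using iff by blast
    have mem: "fst (f u) \<in> pverts K" "snd (f u) < n (fst (f u))" if "u \<in> pverts G" for u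
      using induced_hom_verts[OF f that] by (auto simp: sub)
    have "induced_hom (\<lambda>u. fst (f u)) G K"
    proof (rule induced_homI)
      fix u v assume uv: "u \<in> pverts G" "v \<in> pverts G"
      show "(u, v) \<in> parcs G \<longleftrightarrow> (fst (f u), fst (f v)) \<in> parcs K"
        using induced_hom_arcs[OF f uv] mem[OF uv(1)] mem[OF uv(2)] loopfree
        by (cases "f u"; cases "f v") (auto simp: sub split: if_splits)
    qed (rule mem)
    moreover have "card {v \<in> pverts G. fst (f v) = x} \<le> n x" for x
    proof (rule card_inj_on_le[where f = "\<lambda>v. snd (f v)" and B = "{..<n x}", simplified])
      show "inj_on (\<lambda>v. snd (f v)) {v \<in> pverts G. fst (f v) = x}"
        using inj by (auto simp: inj_on_def prod_eq_iff)
      show "(\<lambda>v. snd (f v)) ` {v \<in> pverts G. fst (f v) = x} \<subseteq> {..<n x}"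
        using mem by auto
    qed
    ultimately show ?R by blast
  next
    assume ?R
    then obtain \<phi> where \<phi>: "induced_hom \<phi> G K"
      and le: "\<And>x. x \<in> pverts K \<Longrightarrow> card {v \<in> pverts G. \<phi> v = x} \<le> n x"
      by blast
    \<comment> \<open>Each fibre fits into \<open>{..<n x}\<close>, so its vertices can be numbered;
      colour and number together give the embedding.\<close>
    have "\<exists>g. g ` {v \<in> pverts G. \<phi> v = x} \<subseteq> {..<n x} \<and> inj_on g {v \<in> pverts G. \<phi> v = x}"
      if "x \<in> pverts K" for x
      using le[OF that] G(2) by (intro card_le_inj) auto
    then obtain g where g: "\<And>x. x \<in> pverts K \<Longrightarrow> g x ` {v \<in> pverts G. \<phi> v = x} \<subseteq> {..<n x}"
      "\<And>x. x \<in> pverts K \<Longrightarrow> inj_on (g x) {v \<in> pverts G. \<phi> v = x}"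
      by metis
    let ?f = "\<lambda>v. (\<phi> v, g (\<phi> v) v)"
    have mem: "\<phi> v \<in> pverts K" "g (\<phi> v) v < n (\<phi> v)" if "v \<in> pverts G" for v
      using induced_hom_verts[OF \<phi> that] g(1)[of "\<phi> v"] that by auto
    have "inj_on ?f (pverts G)"
    proof (rule inj_onI)
      fix u v assume uv: "u \<in> pverts G" "v \<in> pverts G" and eq: "?f u = ?f v"
      show "u = v" using uv eq by (intro inj_onD[OF g(2)[OF mem(1)[OF uv(1)]]]) auto
    qed
    moreover have "induced_hom ?f G (stable_substitution K n)"
      by (rule induced_homI) (use mem loopfree in \<open>auto simp: sub induced_hom_arcs[OF \<phi>, symmetric]\<close>)
    ultimately show ?L using iff by blast
  qed
qed

section \<open>Colourings by the pentagon and the family \<open>F2\<close>\<close>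

text \<open>The adjacent colours 1 and 2 may repeat, the other three may not, and any colour may be
  absent. This describes the induced subgraphs of a pentagon with two adjacent vertices replaced by
  stable sets.\<close>

definition C5_colouring :: "('a \<Rightarrow> nat) \<Rightarrow> 'a pair_pre_digraph \<Rightarrow> bool" where
  "C5_colouring \<phi> G \<longleftrightarrow>
     induced_hom \<phi> G C5 \<and> (\<forall>x\<in>{3, 4, 5}. card {v \<in> pverts G. \<phi> v = x} \<le> 1)"

lemma pverts_P4: "pverts P4 = {1, 2, 3, 4}"
  and parcs_P4: "parcs P4 = {(1, 2), (2, 1), (2, 3), (3, 2), (3, 4), (4, 3)}"
  by (auto simp: P4_def edge_graph_def Field_def)

lemma pverts_C5: "pverts C5 = {1, 2, 3, 4, 5}"
  and parcs_C5: "parcs C5 = {(1, 2), (2, 1), (2, 3), (3, 2), (3, 4), (4, 3), (4, 5), (5, 4), (5, 1), (1, 5)}"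
  by (auto simp: C5_def edge_graph_def Field_def)

lemma C5_sym: "(x, y) \<in> parcs C5 \<Longrightarrow> (y, x) \<in> parcs C5"
  and C5_irrefl: "(x, x) \<notin> parcs C5"
  by (auto simp: parcs_C5)

text \<open>Two placements of the path on the pentagon: the first puts its initial two vertices on
  the repeatable colours 1 and 2, the second its two inner vertices.\<close>

lemma induced_hom_P4_C5: "induced_hom id P4 C5"
  and induced_hom_P4_C5': "induced_hom (\<lambda>x. if x = 1 then 5 else x - 1) P4 C5"
  by (auto simp: induced_hom_def pverts_P4 parcs_P4 pverts_C5 parcs_C5)

text \<open>Every member of \<open>F2\<close> maps to the pentagon with its enlarged classes on
  colours 1 and 2. Conversely a colouring embeds the graph into a member of
  \<open>F2_3\<close>.\<close>

lemma F2_iff_C5_colouring: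
  assumes G: "pair_wf_digraph G" "finite (pverts G)"
  shows "(\<exists>H\<in>F2. iso_to_induced_subgraph G H) \<longleftrightarrow> (\<exists>\<phi>. C5_colouring \<phi> G)"
proof -
  have P4: "iso_to_induced_subgraph G (stable_substitution P4 n) \<longleftrightarrow>
      (\<exists>\<phi>. induced_hom \<phi> G P4 \<and> (\<forall>x\<in>pverts P4. card {v \<in> pverts G. \<phi> v = x} \<le> n x))" for n
    by (rule iso_to_induced_stable_substitution_iff[OF G]) (simp add: parcs_P4)
  have C5: "iso_to_induced_subgraph G (stable_substitution C5 n) \<longleftrightarrow>
      (\<exists>\<phi>. induced_hom \<phi> G C5 \<and> (\<forall>x\<in>pverts C5. card {v \<in> pverts G. \<phi> v = x} \<le> n x))" for n
    by (rule iso_to_induced_stable_substitution_iff[OF G]) (simp add: parcs_C5)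
  show ?thesis
  proof
    assume "\<exists>H\<in>F2. iso_to_induced_subgraph G H"
    then obtain H where H: "H \<in> F2" and GH: "iso_to_induced_subgraph G H" by blast
    from H consider m n where "complete_bipartite_digraph m n (with_proj H)"
      | m n where "H = stable_substitution P4 ((\<lambda>_. 1)(1 := m, 2 := n))"
      | m n where "H = stable_substitution P4 ((\<lambda>_. 1)(2 := m, 3 := n))"
      | m n where "H = stable_substitution C5 ((\<lambda>_. 1)(1 := m, 2 := n))"
      by (auto simp: F2_def F2_1_def F2_2_def F2_3_def)
    then show "\<exists>\<phi>. C5_colouring \<phi> G"
    proof cases
      case 1
      then obtain U W where UW: "pverts H = U \<union> W" "U \<inter> W = {}"
      "parcs H = U \<times> W \<union> W \<times> U"
        unfolding complete_bipartite_digraph_pair_def by blast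
      then have disjoint: "\<And>x. x \<in> U \<Longrightarrow> x \<notin> W" by blast
      have "pair_wf_digraph H" by unfold_locales (auto simp: UW)
      then obtain f where f: "induced_hom f G H"
        using GH iso_to_induced_subgraph_iff[OF G(1)] by blast
      have "induced_hom (\<lambda>v. if v \<in> U then 1 else 2) H C5"
        using disjoint by (auto simp: induced_hom_def UW pverts_C5 parcs_C5)
      from induced_hom_comp[OF f this] show ?thesis
        by (intro exI[of _ "(\<lambda>v. if v \<in> U then 1 else 2) \<circ> f"]) (simp add: C5_colouring_def)
    next
      case 2
      with GH P4 obtain \<phi> where "induced_hom \<phi> G P4"
        and \<phi>: "\<forall>x\<in>pverts P4. card {v \<in> pverts G. \<phi> v = x} \<le> ((\<lambda>_. 1)(1 := m, 2 := n)) x"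
        by blast
      then have "induced_hom (id \<circ> \<phi>) G C5" by (blast intro: induced_hom_comp induced_hom_P4_C5)
      \<comment> \<open>Colour 5 is missed because \<open>P4\<close> has no such vertex.\<close>
      moreover have "card {v \<in> pverts G. \<phi> v = 5} = 0"
        using induced_hom_verts[OF \<open>induced_hom \<phi> G P4\<close>] by (force simp: pverts_P4 card_eq_0_iff)
      ultimately show ?thesis using \<phi> by (intro exI[of _ \<phi>]) (simp add: C5_colouring_def pverts_P4)
    next
      case 3
      with GH P4 obtain \<phi> where h: "induced_hom \<phi> G P4"
        and \<phi>: "\<forall>x\<in>pverts P4. card {v \<in> pverts G. \<phi> v = x} \<le> ((\<lambda>_. 1)(2 := m, 3 := n)) x"
        by blast
      let ?\<psi> = "(\<lambda>x. if x = 1 then 5 else x - 1) \<circ> \<phi>"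
      have "induced_hom ?\<psi> G C5" by (rule induced_hom_comp[OF h induced_hom_P4_C5'])
      moreover have "{v \<in> pverts G. ?\<psi> v = 3} = {v \<in> pverts G. \<phi> v = 4}"
        "card {v \<in> pverts G. ?\<psi> v = 4} = 0"
      "{v \<in> pverts G. ?\<psi> v = 5} = {v \<in> pverts G. \<phi> v = 1}"
        using induced_hom_verts[OF h] by (force simp: pverts_P4 card_eq_0_iff)+
      ultimately show ?thesis
        using \<phi> by (intro exI[of _ ?\<psi>]) (simp add: C5_colouring_def pverts_P4 del: comp_apply)
    next
      case 4
      with GH C5 obtain \<phi> where "induced_hom \<phi> G C5"
        and "\<forall>x\<in>pverts C5. card {v \<in> pverts G. \<phi> v = x} \<le> ((\<lambda>_. 1)(1 := m, 2 := n)) x"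
        by blast
      then show ?thesis by (intro exI[of _ \<phi>]) (simp add: C5_colouring_def pverts_C5)
    qed
  next
    assume "\<exists>\<phi>. C5_colouring \<phi> G"
    then obtain \<phi> where \<phi>: "C5_colouring \<phi> G" by blast
    \<comment> \<open>Both repeatable classes get room for all of \<open>G\<close>;
      \<open>Suc\<close> keeps the sizes positive as \<open>F2_3\<close> demands.\<close>
    let ?N = "Suc (card (pverts G))"
    let ?H = "stable_substitution C5 ((\<lambda>_. 1)(1 := ?N, 2 := ?N))"
    have "card {v \<in> pverts G. \<phi> v = x} \<le> ?N" for x
      using card_mono[OF G(2), of "{v \<in> pverts G. \<phi> v = x}"] by auto
    then have "iso_to_induced_subgraph G ?H"
      using \<phi> unfolding C5 C5_colouring_def by (intro exI[of _ \<phi>]) (auto simp: pverts_C5)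
    moreover have "?H \<in> F2" unfolding F2_def F2_3_def by blast
    ultimately show "\<exists>H\<in>F2. iso_to_induced_subgraph G H" by blast
  qed
qed

section \<open>Triangles among the members of \<open>F3\<close>\<close>

abbreviation "P5 \<equiv> clone_graph {(1,2), (2,3), (3,4), (4,5)} {} {}"
abbreviation "G6_1 \<equiv> clone_graph {(1,5), (4,6), (5,6)} {1, 4} {}"
abbreviation "G6_3 \<equiv> clone_graph {(1,5), (1,6), (4,6)} {1, 4} {}"
abbreviation "G6_9 \<equiv> clone_graph {(1,4), (1,5), (1,6), (2,5), (2,6), (3,6)} {} {}"

lemma pair_wf_clone_graph: "pair_wf_digraph (clone_graph E W B)"
  by (simp add: clone_graph_def pair_wf_substitution)

lemma pverts_clone_graph:
  "(u, i) \<in> pverts (clone_graph E W B) \<longleftrightarrow> u \<in> Field E \<and> (i = 0 \<or> i = 1 \<and> u \<in> W \<union> B)"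
  by (auto simp: clone_graph_def pverts_substitution edge_graph_def)

lemma parcs_clone_graph:
  "((u, i), (v, j)) \<in> parcs (clone_graph E W B) \<longleftrightarrow>
    (u, i) \<in> pverts (clone_graph E W B) \<and> (v, j) \<in> pverts (clone_graph E W B) \<and>
    (if u = v then u \<in> B \<and> i \<noteq> j else (u, v) \<in> E \<or> (v, u) \<in> E)"
  by (auto simp: clone_graph_def pverts_substitution parcs_substitution edge_graph_def)

text \<open>Phrased by arcs alone, so that any \<open>induced_hom\<close> carries a triangle
  forward, injective or not.\<close>

definition has_triangle :: "'a pair_pre_digraph \<Rightarrow> bool" where
  "has_triangle H \<longleftrightarrow> (\<exists>u v w. (u, v) \<in> parcs H \<and> (v, w) \<in> parcs H \<and> (u, w) \<in> parcs H)"

text \<open>A doubled clique vertex and any neighbour form a triangle. Otherwise the triangle is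
  sought with edges oriented as \<open>(u, v)\<close>, \<open>(v, w)\<close>, \<open>(u, w)\<close>,
  which suits lists whose edges go from the smaller to the larger vertex. On a concrete list the
  bounded quantifiers can be evaluated by simplification.\<close>

lemma has_triangle_clone_graph:
  assumes "\<exists>(u, v)\<in>E. u \<noteq> v \<and> (u \<in> B \<or> v \<in> B \<or> (\<exists>(v', w)\<in>E. v' = v \<and> (u, w) \<in> E \<and> v \<noteq> w \<and> u \<noteq> w))"
  shows "has_triangle (clone_graph E W B)"
proof -
  obtain u v where uv: "(u, v) \<in> E" "u \<noteq> v" "u \<in> Field E" "v \<in> Field E"
    and "u \<in> B \<or> v \<in> B \<or> (\<exists>w. (v, w) \<in> E \<and> (u, w) \<in> E \<and> v \<noteq> w \<and> u \<noteq> w)"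
    using assms by (auto simp: Field_def)
  then consider "u \<in> B" | "v \<in> B" | w where "(v, w) \<in> E" "(u, w) \<in> E" "v \<noteq> w" "u \<noteq> w" "w \<in> Field E"
    by (auto simp: Field_def)
  then show ?thesis
  proof cases
    case 1 then show ?thesis unfolding has_triangle_def using uv
      by (intro exI[of _ "(u, 0)"] exI[of _ "(u, 1)"] exI[of _ "(v, 0)"])
        (simp add: parcs_clone_graph pverts_clone_graph)
  next
    case 2 then show ?thesis unfolding has_triangle_def using uv
      by (intro exI[of _ "(v, 0)"] exI[of _ "(v, 1)"] exI[of _ "(u, 0)"])
        (simp add: parcs_clone_graph pverts_clone_graph)
  next
    case 3 then show ?thesis unfolding has_triangle_def using uv
      by (intro exI[of _ "(u, 0)"] exI[of _ "(v, 0)"] exI[of _ "(w, 0)"])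
        (simp add: parcs_clone_graph pverts_clone_graph)
  qed
qed

lemma F3_triangle_free_members:
  assumes "H \<in> F3" "\<not> has_triangle H"
  shows "H \<in> {P5, G6_1, G6_3, G6_9}"
proof -
  have "\<forall>H\<in>F3. has_triangle H \<or> H = P5 \<or> H = G6_1 \<or> H = G6_3 \<or> H = G6_9"
    unfolding F3_def ball_simps(7)
    \<comment> \<open>The first alternative settles the four named graphs by a reflexive equation,
      the second checks the triangle criterion on the edge list, and the last closes the quantifier
      over the empty set that ends the enumeration.\<close>
    by (intro conjI; (simp only: simp_thms; fail | rule disjI1, rule has_triangle_clone_graph, simp; fail | simp))
  then show ?thesis using assms by blast
qed

section \<open>Obstructions to colouring\<close>

lemma C5_neighbours:
  "(x, Suc 0) \<in> parcs C5 \<longleftrightarrow> x = 2 \<or> x = 5"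
      "(Suc 0, x) \<in> parcs C5 \<longleftrightarrow> x = 2 \<or> x = 5"
  "(x, 2) \<in> parcs C5 \<longleftrightarrow> x = 1 \<or> x = 3"
      "(2, x) \<in> parcs C5 \<longleftrightarrow> x = 1 \<or> x = 3"
  "(x, 3) \<in> parcs C5 \<longleftrightarrow> x = 2 \<or> x = 4"
      "(3, x) \<in> parcs C5 \<longleftrightarrow> x = 2 \<or> x = 4"
  "(x, 4) \<in> parcs C5 \<longleftrightarrow> x = 3 \<or> x = 5"
      "(4, x) \<in> parcs C5 \<longleftrightarrow> x = 3 \<or> x = 5"
  "(x, 5) \<in> parcs C5 \<longleftrightarrow> x = 4 \<or> x = 1"
      "(5, x) \<in> parcs C5 \<longleftrightarrow> x = 4 \<or> x = 1"
  by (auto simp: parcs_C5)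

lemma has_triangle_induced_hom:
  assumes "induced_hom f H G" "pair_wf_digraph H" "has_triangle H"
  shows "has_triangle G"
proof -
  interpret H: pair_wf_digraph H by fact
  obtain u v w where uvw: "(u, v) \<in> parcs H" "(v, w) \<in> parcs H" "(u, w) \<in> parcs H"
    using assms(3) by (auto simp: has_triangle_def)
  then have "u \<in> pverts H" "v \<in> pverts H" "w \<in> pverts H"
    by (auto dest: H.in_arcsD1 H.in_arcsD2)
  then have "(f u, f v) \<in> parcs G" "(f v, f w) \<in> parcs G" "(f u, f w) \<in> parcs G"
    using uvw by (simp_all add: induced_hom_arcs[OF assms(1)])
  then show ?thesis by (auto simp: has_triangle_def)
qed

lemma C5_triangle_free: "\<not> has_triangle C5"
proof
  assume "has_triangle C5"
  then obtain u v w where uvw: "(u, v) \<in> parcs C5" "(v, w) \<in> parcs C5" "(u, w) \<in> parcs C5"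
    by (auto simp: has_triangle_def)
  then have "u \<in> {1, 2, 3, 4, 5}" by (auto simp: parcs_C5)
  then show False using uvw by (auto simp: C5_neighbours)
qed

lemma C5_colouring_inj:
  assumes "C5_colouring \<phi> G" "finite (pverts G)" "u \<in> pverts G" "v \<in> pverts G" "\<phi> u = \<phi> v"
      "\<phi> u \<in> {3, 4, 5}"
  shows "u = v"
  using assms by (auto simp: C5_colouring_def card_le_Suc0_iff_eq)

text \<open>Injectivity of \<open>f\<close> keeps the colour classes from growing, so colourability
  is inherited by induced subgraphs.\<close>

lemma C5_colouring_comp:
  assumes "C5_colouring \<phi> G" "finite (pverts G)" "induced_hom f H G" "inj_on f (pverts H)"
  shows "C5_colouring (\<phi> \<circ> f) H"
proof -
  have "card {v \<in> pverts H. (\<phi> \<circ> f) v = x} \<le> card {v \<in> pverts G. \<phi> v = x}" for x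
    using assms(2-4) by (intro card_inj_on_le[of f]) (auto simp: induced_hom_verts inj_on_def)
  then show ?thesis
    using assms(1) induced_hom_comp[OF assms(3)] unfolding C5_colouring_def by (meson le_trans)
qed

lemma finite_clone_graph:
  assumes "finite E"
  shows "finite (pverts (clone_graph E W B))"
  using assms by (simp add: clone_graph_def pverts_substitution edge_graph_def finite_Field)

text \<open>If the path backtracked on the pentagon, one of the nonadjacent pairs 1, 4 and 2, 5
  would become adjacent. Hence its images run once round the pentagon, and the two ends become
  adjacent.\<close>

lemma P5_not_C5_colourable: "\<not> C5_colouring \<phi> P5"
proof
  assume \<phi>: "C5_colouring \<phi> P5"
  then have hom: "induced_hom \<phi> P5 C5" by (simp add: C5_colouring_def)
  define c where "c i j = \<phi> (i, j)" for i j
  have arcs: "(c u i, c v j) \<in> parcs C5 \<longleftrightarrow> ((u, i), (v, j)) \<in> parcs P5"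
    if "(u, i) \<in> pverts P5" "(v, j) \<in> pverts P5" for u i v j
    using induced_hom_arcs[OF hom that] by (simp add: c_def)
  have "c 3 0 \<in> pverts C5"
    using induced_hom_verts[OF hom, of "(3, 0)"]
    by (simp add: c_def pverts_clone_graph)
  moreover have "(c 1 0, c 2 0) \<in> parcs C5"
    "(c 2 0, c 3 0) \<in> parcs C5"
    "(c 3 0, c 4 0) \<in> parcs C5"
    "(c 4 0, c 5 0) \<in> parcs C5"
    "(c 1 0, c 4 0) \<notin> parcs C5"
    "(c 1 0, c 5 0) \<notin> parcs C5"
    "(c 2 0, c 5 0) \<notin> parcs C5"
    by (simp_all add: arcs parcs_clone_graph pverts_clone_graph)
  ultimately show False by (auto simp: pverts_C5 C5_neighbours)
qed

text \<open>Both copies of 1 must get the neighbour of the colour of 5 other than the colour of 6,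
  and symmetrically for 4. The two repeated colours are then distinct and nonadjacent, whereas only
  1 and 2 may repeat.\<close>

lemma G6_1_not_C5_colourable: "\<not> C5_colouring \<phi> G6_1"
proof
  assume \<phi>: "C5_colouring \<phi> G6_1"
  then have hom: "induced_hom \<phi> G6_1 C5" by (simp add: C5_colouring_def)
  define c where "c i j = \<phi> (i, j)" for i j
  have arcs: "(c u i, c v j) \<in> parcs C5 \<longleftrightarrow> ((u, i), (v, j)) \<in> parcs G6_1"
    if "(u, i) \<in> pverts G6_1" "(v, j) \<in> pverts G6_1" for u i v j
    using induced_hom_arcs[OF hom that] by (simp add: c_def)
  have "c 5 0 \<in> pverts C5"
    using induced_hom_verts[OF hom, of "(5, 0)"]
    by (simp add: c_def pverts_clone_graph)
  moreover have "(c 5 0, c 6 0) \<in> parcs C5"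
    "(c 1 0, c 5 0) \<in> parcs C5"
    "(c 1 1, c 5 0) \<in> parcs C5"
    "(c 4 0, c 6 0) \<in> parcs C5"
    "(c 4 1, c 6 0) \<in> parcs C5"
    "(c 1 0, c 4 0) \<notin> parcs C5"
    "(c 1 0, c 4 1) \<notin> parcs C5"
    "(c 1 1, c 4 0) \<notin> parcs C5"
    "(c 1 1, c 4 1) \<notin> parcs C5"
    by (simp_all add: arcs parcs_clone_graph pverts_clone_graph)
  moreover have "c 1 0 \<noteq> c 1 1 \<or> c 1 0 \<notin> {3, 4, 5}"
      "c 4 0 \<noteq> c 4 1 \<or> c 4 0 \<notin> {3, 4, 5}"
    using C5_colouring_inj[OF \<phi> finite_clone_graph, of "(1, 0)" "(1, 1)"]
      C5_colouring_inj[OF \<phi> finite_clone_graph, of "(4, 0)" "(4, 1)"]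
    by (auto simp: c_def pverts_clone_graph)
  ultimately show False by (auto simp: pverts_C5 C5_neighbours)
qed

text \<open>The colours of 5 and 6 differ, so they have only one common neighbour, which both copies
  of 1 receive; both copies of 4 receive the other neighbour of the colour of 6. Again two
  nonadjacent colours repeat.\<close>

lemma G6_3_not_C5_colourable: "\<not> C5_colouring \<phi> G6_3"
proof
  assume \<phi>: "C5_colouring \<phi> G6_3"
  then have hom: "induced_hom \<phi> G6_3 C5" by (simp add: C5_colouring_def)
  define c where "c i j = \<phi> (i, j)" for i j
  have arcs: "(c u i, c v j) \<in> parcs C5 \<longleftrightarrow> ((u, i), (v, j)) \<in> parcs G6_3"
    if "(u, i) \<in> pverts G6_3" "(v, j) \<in> pverts G6_3" for u i v j
    using induced_hom_arcs[OF hom that] by (simp add: c_def)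
  have "c 6 0 \<in> pverts C5"
    using induced_hom_verts[OF hom, of "(6, 0)"]
    by (simp add: c_def pverts_clone_graph)
  moreover have "(c 1 0, c 5 0) \<in> parcs C5"
    "(c 1 1, c 5 0) \<in> parcs C5"
    "(c 1 0, c 6 0) \<in> parcs C5"
    "(c 1 1, c 6 0) \<in> parcs C5"
    "(c 4 0, c 6 0) \<in> parcs C5"
    "(c 4 1, c 6 0) \<in> parcs C5"
    "(c 5 0, c 4 0) \<notin> parcs C5"
    "(c 5 0, c 4 1) \<notin> parcs C5"
    by (simp_all add: arcs parcs_clone_graph pverts_clone_graph)
  moreover have "c 1 0 \<noteq> c 1 1 \<or> c 1 0 \<notin> {3, 4, 5}"
      "c 4 0 \<noteq> c 4 1 \<or> c 4 0 \<notin> {3, 4, 5}"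
    using C5_colouring_inj[OF \<phi> finite_clone_graph, of "(1, 0)" "(1, 1)"]
      C5_colouring_inj[OF \<phi> finite_clone_graph, of "(4, 0)" "(4, 1)"]
    by (auto simp: c_def pverts_clone_graph)
  ultimately show False by (auto simp: pverts_C5 C5_neighbours)
qed

text \<open>The vertices 4, 5, 6 are told apart by 2 and 3, so their colours are three distinct
  neighbours of the colour of 1; the pentagon has degree two.\<close>

lemma G6_9_not_C5_colourable: "\<not> C5_colouring \<phi> G6_9"
proof
  assume \<phi>: "C5_colouring \<phi> G6_9"
  then have hom: "induced_hom \<phi> G6_9 C5" by (simp add: C5_colouring_def)
  define c where "c i j = \<phi> (i, j)" for i j
  have arcs: "(c u i, c v j) \<in> parcs C5 \<longleftrightarrow> ((u, i), (v, j)) \<in> parcs G6_9"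
    if "(u, i) \<in> pverts G6_9" "(v, j) \<in> pverts G6_9" for u i v j
    using induced_hom_arcs[OF hom that] by (simp add: c_def)
  have "c 1 0 \<in> pverts C5"
    using induced_hom_verts[OF hom, of "(1, 0)"]
    by (simp add: c_def pverts_clone_graph)
  moreover have "(c 1 0, c 4 0) \<in> parcs C5"
    "(c 1 0, c 5 0) \<in> parcs C5"
    "(c 1 0, c 6 0) \<in> parcs C5"
    "(c 2 0, c 5 0) \<in> parcs C5"
    "(c 2 0, c 6 0) \<in> parcs C5"
    "(c 3 0, c 6 0) \<in> parcs C5"
    "(c 2 0, c 4 0) \<notin> parcs C5"
    "(c 3 0, c 4 0) \<notin> parcs C5"
    "(c 3 0, c 5 0) \<notin> parcs C5"
    by (simp_all add: arcs parcs_clone_graph pverts_clone_graph)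
  ultimately show False by (auto simp: pverts_C5 C5_neighbours)
qed

section \<open>Embedding the four obstructions into a triangle-free graph\<close>

locale triangle_free_graph = pair_graph G for G :: "'a pair_pre_digraph" +
  assumes triangle_free: "\<And>u v w. (u, v) \<in> parcs G \<Longrightarrow> (v, w) \<in> parcs G \<Longrightarrow> (u, w) \<notin> parcs G"
begin

abbreviation adj (infix "\<frown>" 50) where "u \<frown> v \<equiv> (u, v) \<in> parcs G"

lemma adj_sym: "u \<frown> v \<Longrightarrow> v \<frown> u"
  using sym_arcs by (auto simp: symmetric_def dest: symD)

lemma adj_commute: "u \<frown> v \<longleftrightarrow> v \<frown> u"
  using adj_sym by blast

lemma nonadj_sym: "\<not> u \<frown> v \<Longrightarrow> \<not> v \<frown> u"
  using adj_sym by blast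

lemma adj_irrefl: "\<not> u \<frown> u"
  using no_loops by fastforce

lemma common_neighbour: "w \<frown> u \<Longrightarrow> w \<frown> v \<Longrightarrow> \<not> u \<frown> v"
  using triangle_free adj_sym by blast

text \<open>Triangle-freeness supplies the nonadjacency of pairs with a common neighbour, and the
  vertices are distinct because their adjacencies differ.\<close>

lemma P5_embedding:
  assumes arcs: "a \<frown> b" "b \<frown> c" "c \<frown> d" "d \<frown> e"
    and nonarcs: "\<not> a \<frown> d" "\<not> b \<frown> e" "\<not> a \<frown> e"
  shows "iso_to_induced_subgraph P5 G"
proof -
  have nonarcs': "\<not> a \<frown> c" "\<not> b \<frown> d" "\<not> c \<frown> e"
    using arcs triangle_free adj_sym by blast+
  note arcs = arcs arcs[THEN adj_sym]
  note nonarcs = nonarcs nonarcs' adj_irrefl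
  have ne: "a \<noteq> b" "a \<noteq> c" "a \<noteq> d" "a \<noteq> e" "b \<noteq> c" "b \<noteq> d" "b \<noteq> e" "c \<noteq> d" "c \<noteq> e" "d \<noteq> e"
    using arcs nonarcs by blast+
  \<comment> \<open>The default value \<open>a\<close> is the image of
    \<open>(1, 0)\<close>.\<close>
  define f where "f = ((\<lambda>_. a)((2, 0) := b, (3, 0) := c, (4, 0) := d, (5, 0) := e) :: nat \<times> nat \<Rightarrow> 'a)"
  have V: "pverts P5 = {(1, 0), (2, 0), (3, 0), (4, 0), (5, 0)}"
    by (auto simp: pverts_clone_graph Field_def)
  have verts: "a \<in> pverts G" "b \<in> pverts G" "c \<in> pverts G" "d \<in> pverts G" "e \<in> pverts G"
    using arcs in_arcsD1 by blast+
  have "inj_on f (pverts P5)"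
    unfolding V by (simp add: f_def ne ne[symmetric])
  moreover have "induced_hom f P5 G"
    unfolding induced_hom_def V by (simp add: f_def verts arcs nonarcs nonarcs[THEN nonadj_sym] parcs_clone_graph pverts_clone_graph)
  ultimately show ?thesis
    using iso_to_induced_subgraph_iff[OF pair_wf_clone_graph pair_wf_digraph_axioms] by blast
qed

text \<open>An edge \<open>p\<close>, \<open>q\<close> with two leaves at each end. Leaves at the
  same end are twins that adjacency cannot separate, so their distinctness is assumed.\<close>

lemma G6_1_embedding:
  assumes arcs: "p \<frown> q" "p \<frown> a" "p \<frown> a'" "q \<frown> b" "q \<frown> b'"
    and nonarcs: "\<not> a \<frown> b" "\<not> a \<frown> b'" "\<not> a' \<frown> b" "\<not> a' \<frown> b'"
    and distinct: "a \<noteq> a'" "b \<noteq> b'"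
  shows "iso_to_induced_subgraph G6_1 G"
proof -
  have nonarcs': "\<not> a \<frown> a'" "\<not> a \<frown> q" "\<not> a' \<frown> q" "\<not> b \<frown> b'" "\<not> b \<frown> p" "\<not> b' \<frown> p"
    using arcs triangle_free adj_sym by blast+
  note arcs = arcs arcs[THEN adj_sym]
  note nonarcs = nonarcs nonarcs' adj_irrefl
  have ne: "a \<noteq> b" "a \<noteq> b'" "a \<noteq> p" "a \<noteq> q" "a' \<noteq> b" "a' \<noteq> b'" "a' \<noteq> p" "a' \<noteq> q" "b \<noteq> p" "b \<noteq> q"
      "b' \<noteq> p" "b' \<noteq> q" "p \<noteq> q"
    using arcs nonarcs by blast+
  define f where "f = ((\<lambda>_. a)((1, 1) := a', (4, 0) := b, (4, 1) := b', (5, 0) := p, (6, 0) := q) :: nat \<times> nat \<Rightarrow> 'a)"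
  have V: "pverts G6_1 = {(1, 0), (1, 1), (4, 0), (4, 1), (5, 0), (6, 0)}"
    by (auto simp: pverts_clone_graph Field_def)
  have verts: "a \<in> pverts G" "a' \<in> pverts G" "b \<in> pverts G" "b' \<in> pverts G" "p \<in> pverts G"
      "q \<in> pverts G"
    using arcs in_arcsD1 by blast+
  have "inj_on f (pverts G6_1)"
    unfolding V by (simp add: f_def ne ne[symmetric] distinct distinct[symmetric])
  moreover have "induced_hom f G6_1 G"
    unfolding induced_hom_def V by (simp add: f_def verts arcs nonarcs nonarcs[THEN nonadj_sym] parcs_clone_graph pverts_clone_graph)
  ultimately show ?thesis
    using iso_to_induced_subgraph_iff[OF pair_wf_clone_graph pair_wf_digraph_axioms] by blast
qed

text \<open>A 4-cycle \<open>x\<close>, \<open>p\<close>, \<open>x'\<close>, \<open>q\<close> with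
  two leaves \<open>a\<close>, \<open>a'\<close> at \<open>q\<close>; both primed pairs are
  twins.\<close>

lemma G6_3_embedding:
  assumes arcs: "x \<frown> p" "x \<frown> q" "x' \<frown> p" "x' \<frown> q" "q \<frown> a" "q \<frown> a'"
    and nonarcs: "\<not> p \<frown> a" "\<not> p \<frown> a'"
    and distinct: "x \<noteq> x'" "a \<noteq> a'"
  shows "iso_to_induced_subgraph G6_3 G"
proof -
  have nonarcs': "\<not> x \<frown> x'" "\<not> x \<frown> a" "\<not> x \<frown> a'" "\<not> x' \<frown> a" "\<not> x' \<frown> a'" "\<not> p \<frown> q" "\<not> a \<frown> a'"
    using arcs triangle_free adj_sym by blast+
  note arcs = arcs arcs[THEN adj_sym]
  note nonarcs = nonarcs nonarcs' adj_irrefl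
  have ne: "x \<noteq> p" "x \<noteq> q" "x \<noteq> a" "x \<noteq> a'" "x' \<noteq> p" "x' \<noteq> q" "x' \<noteq> a" "x' \<noteq> a'" "p \<noteq> q" "p \<noteq> a"
      "p \<noteq> a'" "q \<noteq> a" "q \<noteq> a'"
    using arcs nonarcs by blast+
  define f where "f = ((\<lambda>_. x)((1, 1) := x', (5, 0) := p, (6, 0) := q, (4, 0) := a, (4, 1) := a') :: nat \<times> nat \<Rightarrow> 'a)"
  have V: "pverts G6_3 = {(1, 0), (1, 1), (5, 0), (6, 0), (4, 0), (4, 1)}"
    by (auto simp: pverts_clone_graph Field_def)
  have verts: "x \<in> pverts G" "x' \<in> pverts G" "p \<in> pverts G" "q \<in> pverts G" "a \<in> pverts G"
      "a' \<in> pverts G"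
    using arcs in_arcsD1 by blast+
  have "inj_on f (pverts G6_3)"
    unfolding V by (simp add: f_def ne ne[symmetric] distinct distinct[symmetric])
  moreover have "induced_hom f G6_3 G"
    unfolding induced_hom_def V by (simp add: f_def verts arcs nonarcs nonarcs[THEN nonadj_sym] parcs_clone_graph pverts_clone_graph)
  ultimately show ?thesis
    using iso_to_induced_subgraph_iff[OF pair_wf_clone_graph pair_wf_digraph_axioms] by blast
qed

text \<open>A half graph: \<open>r\<close>, \<open>a\<close>, \<open>a'\<close> have the
  neighbourhoods \<open>{s, b, b'}\<close>, \<open>{s, b}\<close>, \<open>{s}\<close>. It has no
  twins, so distinctness follows from adjacency.\<close>

lemma G6_9_embedding:
  assumes arcs: "r \<frown> s" "r \<frown> b" "r \<frown> b'" "s \<frown> a" "s \<frown> a'" "a \<frown> b"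
    and nonarcs: "\<not> a \<frown> b'" "\<not> a' \<frown> b" "\<not> a' \<frown> b'"
  shows "iso_to_induced_subgraph G6_9 G"
proof -
  have nonarcs': "\<not> r \<frown> a" "\<not> r \<frown> a'" "\<not> a \<frown> a'" "\<not> b' \<frown> b" "\<not> b' \<frown> s" "\<not> b \<frown> s"
    using arcs triangle_free adj_sym by blast+
  note arcs = arcs arcs[THEN adj_sym]
  note nonarcs = nonarcs nonarcs' adj_irrefl
  have ne: "r \<noteq> a" "r \<noteq> a'" "r \<noteq> b'" "r \<noteq> b" "r \<noteq> s" "a \<noteq> a'" "a \<noteq> b'" "a \<noteq> b" "a \<noteq> s" "a' \<noteq> b'"
      "a' \<noteq> b" "a' \<noteq> s" "b' \<noteq> b" "b' \<noteq> s" "b \<noteq> s"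
    using arcs nonarcs by blast+
  define f where "f = ((\<lambda>_. r)((2, 0) := a, (3, 0) := a', (4, 0) := b', (5, 0) := b, (6, 0) := s) :: nat \<times> nat \<Rightarrow> 'a)"
  have V: "pverts G6_9 = {(1, 0), (2, 0), (3, 0), (4, 0), (5, 0), (6, 0)}"
    by (auto simp: pverts_clone_graph Field_def)
  have verts: "r \<in> pverts G" "a \<in> pverts G" "a' \<in> pverts G" "b' \<in> pverts G" "b \<in> pverts G"
      "s \<in> pverts G"
    using arcs in_arcsD1 by blast+
  have "inj_on f (pverts G6_9)"
    unfolding V by (simp add: f_def ne ne[symmetric])
  moreover have "induced_hom f G6_9 G"
    unfolding induced_hom_def V by (simp add: f_def verts arcs nonarcs nonarcs[THEN nonadj_sym] parcs_clone_graph pverts_clone_graph)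
  ultimately show ?thesis
    using iso_to_induced_subgraph_iff[OF pair_wf_clone_graph pair_wf_digraph_axioms] by blast
qed

end

section \<open>Colouring a connected graph without the four obstructions\<close>

text \<open>Freeness appears as rules contrapositive to the embedding lemmas, each yielding an edge
  or an equality of vertices. Connectedness is put in the form that shows a set of vertices to
  exhaust the graph.\<close>

locale P5_G6_free_graph = triangle_free_graph G for G :: "'a pair_pre_digraph" +
  assumes connected: "\<And>S. S \<subseteq> pverts G \<Longrightarrow> S \<noteq> {} \<Longrightarrow>
      (\<And>u v. u \<in> S \<Longrightarrow> (u, v) \<in> parcs G \<Longrightarrow> v \<in> S) \<Longrightarrow> S = pverts G"
    and has_arc: "parcs G \<noteq> {}"
    and P5_free: "\<And>a b c d e. (a, b) \<in> parcs G \<Longrightarrow> (b, c) \<in> parcs G \<Longrightarrow> (c, d) \<in> parcs G \<Longrightarrow>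
      (d, e) \<in> parcs G \<Longrightarrow> (a, d) \<notin> parcs G \<Longrightarrow> (b, e) \<notin> parcs G \<Longrightarrow> (a, e) \<in> parcs G"
    and G6_1_free: "\<And>p q a a' b b'. (p, q) \<in> parcs G \<Longrightarrow>
      (p, a) \<in> parcs G \<Longrightarrow> (p, a') \<in> parcs G \<Longrightarrow> (q, b) \<in> parcs G \<Longrightarrow> (q, b') \<in> parcs G \<Longrightarrow>
      (a, b) \<notin> parcs G \<Longrightarrow> (a, b') \<notin> parcs G \<Longrightarrow> (a', b) \<notin> parcs G \<Longrightarrow> (a', b') \<notin> parcs G \<Longrightarrow>
      a = a' \<or> b = b'"
    and G6_3_free: "\<And>x x' p q a a'. (x, p) \<in> parcs G \<Longrightarrow> (x, q) \<in> parcs G \<Longrightarrow>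
      (x', p) \<in> parcs G \<Longrightarrow> (x', q) \<in> parcs G \<Longrightarrow> (q, a) \<in> parcs G \<Longrightarrow> (q, a') \<in> parcs G \<Longrightarrow>
      (p, a) \<notin> parcs G \<Longrightarrow> (p, a') \<notin> parcs G \<Longrightarrow> x = x' \<or> a = a'"
    and G6_9_free: "\<And>r s a a' b b'. (r, s) \<in> parcs G \<Longrightarrow> (r, b) \<in> parcs G \<Longrightarrow> (r, b') \<in> parcs G \<Longrightarrow>
      (s, a) \<in> parcs G \<Longrightarrow> (s, a') \<in> parcs G \<Longrightarrow> (a, b) \<in> parcs G \<Longrightarrow>
      (a, b') \<notin> parcs G \<Longrightarrow> (a', b) \<notin> parcs G \<Longrightarrow> (a', b') \<in> parcs G"
begin

text \<open>The classes \<open>T i\<close> make the graph a pentagon with vertices replaced by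
  stable sets. Classes with several vertices occupy at most two consecutive positions, and a
  rotation by \<open>k\<close> moves these to colours 1 and 2.\<close>

lemma colouring_around_pentagon:
  assumes period: "\<And>i::nat. c (i + 5) = c i" and cycle: "\<And>i. c i \<frown> c (i + 1)"
  shows "\<exists>\<phi>. C5_colouring \<phi> G"
proof -
  \<comment> \<open>the vertices that see the pentagon as \<open>c i\<close> does; \<open>i + 4\<close> stands for \<open>i - 1\<close>\<close>
  define T where "T i = {v. v \<frown> c (i + 4) \<and> v \<frown> c (i + 1)}" for i
  have T_period: "T (i + 5) = T i" for i
    using period[of "i + 4"] period[of "i + 1"] by (simp add: T_def add.commute add.left_commute)
  have cycle4: "c i \<frown> c (i + 4)" for i
    using cycle[of "i + 4"] period[of i] adj_sym by (simp add: eval_nat_numeral)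
  have step: "c (i + 1) \<frown> c (i + 2)" "c (i + 2) \<frown> c (i + 3)" "c (i + 3) \<frown> c (i + 4)" for i
    using cycle[of "i + 1"] cycle[of "i + 2"] cycle[of "i + 3"] by (simp_all add: eval_nat_numeral)
  have cT: "c i \<in> T i" for i
    using cycle cycle4 by (simp add: T_def)
  have T0: "\<not> u \<frown> v" if "u \<in> T i" "v \<in> T i" for u v i
    using that triangle_free adj_sym unfolding T_def by blast
  have T2: "\<not> u \<frown> v" if "u \<in> T i" "v \<in> T (i + 2)" for u v i
  proof -
    have "v \<frown> c (i + 1)"
      using that(2) period[of "i + 1"] by (simp add: T_def eval_nat_numeral)
    then show ?thesis using that(1) common_neighbour adj_sym unfolding T_def by blast
  qed
  \<comment> \<open>Otherwise \<open>u\<close> and \<open>v\<close> would be the ends of an induced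
    path round the far side of the pentagon.\<close>
  have T1: "u \<frown> v" if u: "u \<in> T i" and v: "v \<in> T (i + 1)" for u v i
  proof -
    have v': "v \<frown> c i" "v \<frown> c (i + 2)"
      using v period[of i] by (simp_all add: T_def eval_nat_numeral)
    have u': "u \<frown> c (i + 4)" "u \<frown> c (i + 1)" using u by (simp_all add: T_def)
    have "\<not> u \<frown> c (i + 2)" using u'(2) step(1) triangle_free by blast
    moreover have "\<not> c (i + 4) \<frown> v" using v'(1) cycle4 triangle_free adj_sym by blast
    ultimately show "u \<frown> v"
      using P5_free[of u "c (i + 4)" "c (i + 3)" "c (i + 2)" v] u' v' step adj_sym by blast
  qed
  have TV: "T i \<subseteq> pverts G" for i by (auto simp: T_def dest: in_arcsD1)
  have cover: "(\<Union>i. T i) = pverts G"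
  proof (rule connected)
    show "(\<Union>i. T i) \<subseteq> pverts G" using TV by blast
    show "(\<Union>i. T i) \<noteq> {}" using cT by blast
    fix v w assume "v \<in> (\<Union>i. T i)" and vw: "v \<frown> w"
    then obtain i where i: "v \<in> T i" by blast
    then have vi: "v \<frown> c (i + 4)" "v \<frown> c (i + 1)" by (simp_all add: T_def)
    \<comment> \<open>Otherwise \<open>w\<close>, \<open>v\<close> and three consecutive pentagon
      vertices would form a \<open>P5\<close>.\<close>
    have "\<exists>j. w \<frown> c j"
    proof (rule ccontr)
      assume none: "\<nexists>j. w \<frown> c j"
      have "\<not> v \<frown> c (i + 3)" using vi(1) step(3) triangle_free adj_sym by blast
      then show False
        using P5_free[of w v "c (i + 1)" "c (i + 2)" "c (i + 3)"] adj_sym[OF vw] vi(2) step none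
        by blast
    qed
    then obtain j where j: "w \<frown> c j" by blast
    have "c (j + 3) \<frown> c (j + 4)" "c (j + 4) \<frown> c j" using step(3) cycle4 adj_sym by blast+
    then have "\<not> c j \<frown> c (j + 3)" using triangle_free adj_sym by blast
    \<comment> \<open>One pentagon neighbour forces a second at distance two, again by
      \<open>P5\<close>-freeness; \<open>w\<close> then belongs to the class of the vertex between
      them.\<close>
    then have "w \<frown> c (j + 2) \<or> w \<frown> c (j + 3)"
      using P5_free[of w "c j" "c (j + 1)" "c (j + 2)" "c (j + 3)"] j step cycle by blast
    then show "w \<in> (\<Union>i. T i)"
    proof
      assume "w \<frown> c (j + 2)"
      then have "w \<in> T (j + 1)" using j period[of j] by (simp add: T_def eval_nat_numeral)
      then show ?thesis by blast
    next
      assume "w \<frown> c (j + 3)"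
      then have "w \<in> T (j + 4)"
        using j period[of j] period[of "j + 3"] by (simp add: T_def eval_nat_numeral)
      then show ?thesis by blast
    qed
  qed
  define big where "big i \<longleftrightarrow> (\<exists>u\<in>T i. \<exists>v\<in>T i. u \<noteq> v)" for i
  have big_period: "big (i + 5) = big i" for i by (simp add: big_def T_period)
  \<comment> \<open>Two vertices in each class would give \<open>G6_3\<close> with the 4-cycle
    through \<open>c (i + 4)\<close> and \<open>c (i + 1)\<close> and leaves at
    \<open>c (i + 1)\<close>.\<close>
  have not_big2: "\<not> big (i + 2)" if "big i" for i
  proof
    assume "big (i + 2)"
    then obtain a a' where a: "a \<in> T (i + 2)" "a' \<in> T (i + 2)" "a \<noteq> a'" by (auto simp: big_def)
    obtain x x' where x: "x \<in> T i" "x' \<in> T i" "x \<noteq> x'" using \<open>big i\<close> by (auto simp: big_def)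
    have "y \<frown> c (i + 1)" "\<not> c (i + 4) \<frown> y" if "y \<in> T (i + 2)" for y
    proof -
      have y: "y \<frown> c (i + 1)" "y \<frown> c (i + 3)"
        using that period[of "i + 1"] by (simp_all add: T_def eval_nat_numeral)
      then show "y \<frown> c (i + 1)" "\<not> c (i + 4) \<frown> y"
        using step(3) triangle_free adj_sym by blast+
    qed
    then show False
      using G6_3_free[of x "c (i + 4)" "c (i + 1)" x' a a'] a x adj_sym unfolding T_def by blast
  qed
  \<comment> \<open>Big classes are never two apart on the cycle. If \<open>i\<close> and
    \<open>i + 1\<close> are big, they become \<open>k + 1\<close> and \<open>k + 2\<close> for
    \<open>k = i + 4\<close>; if only \<open>i\<close> is known to be big, it becomes
    \<open>k + 2\<close> for \<open>k = i + 3\<close>.\<close>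
  have "\<exists>k. \<not> big (k + 3) \<and> \<not> big (k + 4) \<and> \<not> big (k + 5)"
  proof (cases "\<exists>i. big i")
    case True
    then obtain i where i: "big i" by blast
    have "\<not> big (i + 3)" using not_big2[of "i + 3"] big_period[of i] i by (auto simp: eval_nat_numeral)
    show ?thesis
    proof (cases "big (i + 1)")
      case True
      then have "\<not> big (i + 4)"
        using not_big2[of "i + 4"] big_period[of "i + 1"] by (auto simp: eval_nat_numeral)
      then show ?thesis
        using not_big2[OF i] \<open>\<not> big (i + 3)\<close> big_period[of "i + 2"] big_period[of "i + 3"]
          big_period[of "i + 4"] by (intro exI[of _ "i + 4"]) (simp add: eval_nat_numeral)
    next
      case False
      then show ?thesis
        using not_big2[OF i] \<open>\<not> big (i + 3)\<close> big_period[of "i + 1"] big_period[of "i + 2"]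
          big_period[of "i + 3"] by (intro exI[of _ "i + 3"]) (simp add: eval_nat_numeral)
    qed
  qed blast
  then obtain k where k: "\<not> big (k + 3)" "\<not> big (k + 4)" "\<not> big (k + 5)" by blast
  have "\<exists>m\<in>{1, 2, 3, 4, 5}. v \<in> T (k + m)" if v: "v \<in> pverts G" for v
  proof -
    obtain i where i: "v \<in> T i" using v cover by blast
    have T_mod: "T (i + 5 * n) = T i" for i n
    proof (induction n)
      case (Suc n)
      then show ?case using T_period[of "i + 5 * n"] by (simp add: add.commute add.left_commute)
    qed simp
    \<comment> \<open>Modulo 5, \<open>i + 4 * k + 4\<close> is \<open>i - k - 1\<close>, written
      without subtraction; thus \<open>m = r + 1\<close> satisfies \<open>k + m = i\<close> modulo
      5.\<close>
    define r where "r = (i + 4 * k + 4) mod 5"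
    define q where "q = (i + 4 * k + 4) div 5"
    have "q * 5 + r = i + 4 * k + 4" unfolding q_def r_def by (rule div_mult_mod_eq)
    then have "k + (r + 1) + 5 * q = i + 5 * (k + 1)" by simp
    then have "T (k + (r + 1)) = T i" by (metis T_mod)
    moreover have "r + 1 \<in> {1, 2, 3, 4, 5}"
    proof -
      have "r < 5" by (simp add: r_def)
      then show ?thesis by auto
    qed
    ultimately show ?thesis using i by blast
  qed
  then obtain \<phi> where \<phi>: "\<And>v. v \<in> pverts G \<Longrightarrow> \<phi> v \<in> {1, 2, 3, 4, 5} \<and> v \<in> T (k + \<phi> v)"
    by metis
  have arcs: "u \<frown> v \<longleftrightarrow> (m, m') \<in> parcs C5"
    if uT: "u \<in> T (k + m)" and vT: "v \<in> T (k + m')"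
      and m: "m \<le> m'" "m \<in> {1, 2, 3, 4, 5}" "m' \<in> {1, 2, 3, 4, 5}" for u v m m'
  proof -
    obtain d where d: "m' = m + d" "d \<in> {0, 1, 2, 3, 4}" using m by (auto simp: le_iff_add)
    have "u \<frown> v \<longleftrightarrow> d \<in> {1, 4}"
    proof -
      \<comment> \<open>For \<open>d\<close> equal to 3 or 4 the index of \<open>u\<close> is raised
        by a full turn, so that it exceeds that of \<open>v\<close> by 2 or 1.\<close>
      have u5: "u \<in> T (k + m + 5)" using uT T_period by simp
      have v5: "v \<in> T (k + m + d)" using vT d by (simp add: add.assoc)
      consider "d = 0" | "d = 1" | "d = 2" | "d = 3" | "d = 4" using d by blast
      then show ?thesis
      proof cases
        case 1 then show ?thesis using T0 uT v5 by simp
      next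
        case 2 then show ?thesis using T1[OF uT] v5 by simp
      next
        case 3 then show ?thesis using T2[OF uT] v5 by simp
      next
        case 4 then show ?thesis using T2[of v "k + m + 3" u] v5 u5 adj_commute[of u v]
          by (simp add: eval_nat_numeral)
      next
        case 5 then show ?thesis using T1[of v "k + m + 4" u] v5 u5 adj_commute[of u v]
          by (simp add: eval_nat_numeral)
      qed
    qed
    also have "\<dots> \<longleftrightarrow> (m, m') \<in> parcs C5"
    proof -
      have "\<forall>m\<in>{1, 2, 3, 4, 5}. \<forall>d\<in>{0, 1, 2, 3, 4}. m + d \<le> 5 \<longrightarrow> (d \<in> {1, 4} \<longleftrightarrow> (m, m + d) \<in> parcs C5)"
        by (simp add: parcs_C5)
      moreover have "m + d \<le> 5" using m(3) d(1) by auto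
      ultimately show ?thesis using m(2) d by blast
    qed
    finally show ?thesis .
  qed
  have "induced_hom \<phi> G C5"
  proof (rule induced_homI)
    fix u v assume uv: "u \<in> pverts G" "v \<in> pverts G"
    show "u \<frown> v \<longleftrightarrow> (\<phi> u, \<phi> v) \<in> parcs C5"
    proof (cases "\<phi> u \<le> \<phi> v")
      case True
      then show ?thesis using arcs \<phi>[OF uv(1)] \<phi>[OF uv(2)] by blast
    next
      case False
      then have "v \<frown> u \<longleftrightarrow> (\<phi> v, \<phi> u) \<in> parcs C5"
        using arcs \<phi>[OF uv(1)] \<phi>[OF uv(2)] nat_le_linear by blast
      then show ?thesis using adj_commute[of u v] C5_sym by blast
    qed
  qed (use \<phi> in \<open>auto simp: pverts_C5\<close>)
  moreover have "card {v \<in> pverts G. \<phi> v = x} \<le> 1" if "x \<in> {3, 4, 5}" for x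
  proof -
    have "\<not> big (k + x)" using that k by auto
    then have "u = w" if "u \<in> pverts G" "\<phi> u = x" "w \<in> pverts G" "\<phi> w = x" for u w
      using that \<phi>[of u] \<phi>[of w] by (auto simp: big_def)
    then show ?thesis using finite_verts by (auto simp: card_le_Suc0_iff_eq)
  qed
  ultimately show ?thesis unfolding C5_colouring_def by blast
qed

text \<open>The classes form a path \<open>A1\<close>, \<open>B0\<close>, \<open>A0\<close>,
  \<open>B1\<close> with consecutive classes completely joined. It is laid along the pentagon so
  that classes with more than one vertex get colours 1 and 2.\<close>

lemma colouring_of_four_classes:
  assumes V: "pverts G = A0 \<union> A1 \<union> (B0 \<union> B1)"
    and disj: "A0 \<inter> A1 = {}" "B0 \<inter> B1 = {}"
      "(A0 \<union> A1) \<inter> (B0 \<union> B1) = {}"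
    and stable: "\<And>u v. u \<in> A0 \<union> A1 \<Longrightarrow> v \<in> A0 \<union> A1 \<Longrightarrow> \<not> u \<frown> v"
      "\<And>u v. u \<in> B0 \<union> B1 \<Longrightarrow> v \<in> B0 \<union> B1 \<Longrightarrow> \<not> u \<frown> v"
    and arcs: "\<And>u v. u \<in> A0 \<union> A1 \<Longrightarrow> v \<in> B0 \<union> B1 \<Longrightarrow> u \<frown> v \<longleftrightarrow> u \<in> A0 \<or> v \<in> B0"
    and ne: "B0 \<noteq> {}" and small: "card B1 \<le> 1"
  shows "\<exists>\<phi>. C5_colouring \<phi> G"
proof -
  have fin: "finite A0" "finite A1" "finite B0" "finite B1" using finite_verts V by auto
  have arcs': "v \<frown> u \<longleftrightarrow> u \<in> A0 \<or> v \<in> B0" if "u \<in> A0 \<union> A1" "v \<in> B0 \<union> B1" for u v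
    using arcs[OF that] adj_commute by blast
  have D: "\<And>v. v \<in> A0 \<Longrightarrow> v \<notin> A1 \<and> v \<notin> B0 \<and> v \<notin> B1"
      "\<And>v. v \<in> A1 \<Longrightarrow> v \<notin> B0 \<and> v \<notin> B1"
    "\<And>v. v \<in> B0 \<Longrightarrow> v \<notin> B1"
    using disj by blast+
  \<comment> \<open>\<open>p\<close>, \<open>q\<close>, \<open>r\<close>, \<open>s\<close> colour
    \<open>A0\<close>, \<open>A1\<close>, \<open>B0\<close>, \<open>B1\<close>. Colours may
    coincide, hence the unions in the size bound; adjacent \<open>q\<close> and \<open>s\<close> do
    no harm when \<open>B1\<close> is empty.\<close>
  have colour: "\<exists>\<phi>. C5_colouring \<phi> G"
    if col: "{p, q, r, s} \<subseteq> pverts C5" "(p, r) \<in> parcs C5" "(q, r) \<in> parcs C5"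
      "(p, s) \<in> parcs C5"
      "(q, s) \<notin> parcs C5 \<or> B1 = {}" "(p, q) \<notin> parcs C5" "(r, s) \<notin> parcs C5"
      and small: "\<And>x. x \<in> {3, 4, 5} \<Longrightarrow> card ((if p = x then A0 else {}) \<union> (if q = x then A1 else {}) \<union>
        (if r = x then B0 else {}) \<union> (if s = x then B1 else {})) \<le> 1" for p q r s
  proof -
    define \<phi> where "\<phi> v = (if v \<in> A0 then p else if v \<in> A1 then q else if v \<in> B0 then r else s)" for v
    have eqs: "v \<in> A0 \<Longrightarrow> \<phi> v = p" "v \<in> A1 \<Longrightarrow> \<phi> v = q" "v \<in> B0 \<Longrightarrow> \<phi> v = r" "v \<in> B1 \<Longrightarrow> \<phi> v = s" for v
      using D by (auto simp: \<phi>_def)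
    have "induced_hom \<phi> G C5"
    proof (rule induced_homI)
      fix v assume "v \<in> pverts G"
      then show "\<phi> v \<in> pverts C5" using V eqs col(1) by auto
    next
      fix u v assume uv: "u \<in> pverts G" "v \<in> pverts G"
      have AB: "x \<frown> y \<longleftrightarrow> (\<phi> x, \<phi> y) \<in> parcs C5" if "x \<in> A0 \<union> A1" "y \<in> B0 \<union> B1" for x y
        using arcs[OF that] that D eqs col(2-5) by auto
      have A: "(\<phi> x, \<phi> y) \<notin> parcs C5" if "x \<in> A0 \<union> A1" "y \<in> A0 \<union> A1" for x y
        using that eqs col(6) C5_sym C5_irrefl by auto
      have B: "(\<phi> x, \<phi> y) \<notin> parcs C5" if "x \<in> B0 \<union> B1" "y \<in> B0 \<union> B1" for x y
        using that eqs col(7) C5_sym C5_irrefl by auto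
      consider "u \<in> A0 \<union> A1" "v \<in> A0 \<union> A1" | "u \<in> A0 \<union> A1" "v \<in> B0 \<union> B1"
        | "u \<in> B0 \<union> B1" "v \<in> A0 \<union> A1" | "u \<in> B0 \<union> B1" "v \<in> B0 \<union> B1"
        using uv V by blast
      then show "u \<frown> v \<longleftrightarrow> (\<phi> u, \<phi> v) \<in> parcs C5"
      proof cases
        case 1 then show ?thesis using A stable(1) by blast
      next
        case 2 then show ?thesis using AB by blast
      next
        case 3 then show ?thesis using AB[OF 3(2,1)] adj_commute C5_sym by blast
      next
        case 4 then show ?thesis using B stable(2) by blast
      qed
    qed
    moreover have "card {v \<in> pverts G. \<phi> v = x} \<le> 1" if "x \<in> {3, 4, 5}" for x
    proof -
      have "{v \<in> pverts G. \<phi> v = x} = (if p = x then A0 else {}) \<union> (if q = x then A1 else {}) \<union>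
          (if r = x then B0 else {}) \<union> (if s = x then B1 else {})"
        using V eqs by auto
      then show ?thesis using small[OF that] by simp
    qed
    ultimately show ?thesis unfolding C5_colouring_def by blast
  qed
  \<comment> \<open>With \<open>B1\<close> empty two colours suffice. The path from
    \<open>A1\<close> to \<open>B1\<close> is coloured 3, 2, 1, 5 if \<open>A1\<close> has at most
    one vertex; otherwise \<open>A0\<close> has at most one and the colours are 1, 2, 3, 4.\<close>
  consider "B1 = {}" | "card A1 \<le> 1" | x a a' where "x \<in> B1" "a \<in> A1" "a' \<in> A1" "a \<noteq> a'"
    using fin(2) by (auto simp: card_le_Suc0_iff_eq)
  then show ?thesis
  proof cases
    case 1
    then show ?thesis by (intro colour[of 1 1 2 2]) (auto simp: pverts_C5 parcs_C5)
  next
    case 2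
    then show ?thesis using small by (intro colour[of 1 3 2 5]) (auto simp: pverts_C5 parcs_C5)
  next
    case 3
    obtain b where b: "b \<in> B0" using ne by blast
    \<comment> \<open>Distinct \<open>y\<close>, \<open>y'\<close> would form a 4-cycle with
      \<open>x\<close> and \<open>b\<close>; with the leaves \<open>a\<close>, \<open>a'\<close> at
      \<open>b\<close> this is \<open>G6_3\<close>.\<close>
    have "y = y'" if y: "y \<in> A0" "y' \<in> A0" for y y'
    proof (rule ccontr)
      assume "y \<noteq> y'"
      moreover have "\<not> x \<frown> a" "\<not> x \<frown> a'" using 3 arcs' D by auto
      moreover have "y \<frown> x" "y' \<frown> x" "y \<frown> b" "y' \<frown> b" "b \<frown> a" "b \<frown> a'"
        using 3 b y arcs arcs' by auto
      ultimately show False using G6_3_free[of y x b y' a a'] 3(4) by blast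
    qed
    then have "card A0 \<le> 1" using fin(1) by (simp add: card_le_Suc0_iff_eq)
    then show ?thesis using small by (intro colour[of 3 1 2 4]) (auto simp: pverts_C5 parcs_C5)
  qed
qed

text \<open>A bipartition with nested neighbourhoods grows from a vertex \<open>r\<close> of maximum
  degree and a vertex \<open>b0\<close> of maximum degree among its neighbours. The excluded closed
  walks of length 5 are pentagons, as there are no triangles.\<close>

lemma colouring_of_pentagon_free:
  assumes pentagon_free:
    "\<And>a b c d e. a \<frown> b \<Longrightarrow> b \<frown> c \<Longrightarrow> c \<frown> d \<Longrightarrow> d \<frown> e \<Longrightarrow> \<not> e \<frown> a"
  shows "\<exists>\<phi>. C5_colouring \<phi> G"
proof -
  define N where "N v = {w. v \<frown> w}" for v
  have NV: "N v \<subseteq> pverts G" for v by (auto simp: N_def dest: in_arcsD2)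
  then have finN: "finite (N v)" for v using finite_verts finite_subset by blast
  have max: "\<exists>v\<in>S. \<forall>w\<in>S. card (N w) \<le> card (N v)" if "finite S" "S \<noteq> {}" for S
  proof -
    obtain v where "v \<in> S" "card (N v) = (MAX w\<in>S. card (N w))"
      using obtains_MAX[OF \<open>finite S\<close> \<open>S \<noteq> {}\<close>, of "\<lambda>w. card (N w)"] by metis
    then show ?thesis using \<open>finite S\<close> by (intro bexI[of _ v]) auto
  qed
  \<comment> \<open>By \<open>P\<^sub>5\<close>-freeness, a vertex of maximum degree has no vertex at distance 3.\<close>
  obtain r where r: "r \<in> pverts G"
      "\<And>w. w \<in> pverts G \<Longrightarrow> card (N w) \<le> card (N r)"
  proof -
    obtain u v where "u \<frown> v" using has_arc by auto
    then have "pverts G \<noteq> {}" using in_arcsD1 by blast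
    then show ?thesis using that max[OF finite_verts] by blast
  qed
  \<comment> \<open>Otherwise \<open>N v\<close> would be contained in the no larger set
    \<open>N w\<close> and equal to it. This is how maximality of a degree is used below.\<close>
  have not_subset: "\<exists>s\<in>N v. s \<notin> N w" if "card (N w) \<le> card (N v)" "\<exists>s\<in>N w. s \<notin> N v" for v w
    using that card_seteq[OF finN, of "N v" w] by (metis subsetI)
  define B where "B = N r"
  define A where "A = pverts G - B"
  have rA: "r \<in> A" using r(1) adj_irrefl by (simp add: A_def B_def N_def)
  have stableB: "\<not> u \<frown> v" if "u \<in> B" "v \<in> B" for u v
    using that common_neighbour[of r u v] by (simp add: B_def N_def)
  have "{r} \<union> B \<union> \<Union>(N ` B) = pverts G"
  proof (rule connected)
    show "{r} \<union> B \<union> \<Union>(N ` B) \<subseteq> pverts G" using NV r(1) by (auto simp: B_def)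
    fix q x assume "q \<in> {r} \<union> B \<union> \<Union>(N ` B)" and qx: "q \<frown> x"
    then consider "q = r" | "q \<in> B" | p where "p \<in> B" "p \<frown> q" by (auto simp: N_def)
    then show "x \<in> {r} \<union> B \<union> \<Union>(N ` B)"
    proof cases
      case 3
      show ?thesis
      proof (rule ccontr)
        assume x: "x \<notin> {r} \<union> B \<union> \<Union>(N ` B)"
        have "q \<in> pverts G" using qx by (rule in_arcsD1)
        moreover have "x \<in> N q" "x \<notin> N r" using qx x by (auto simp: N_def B_def)
        \<comment> \<open>Maximality of \<open>r\<close> supplies \<open>s\<close>; then
          \<open>s\<close>, \<open>r\<close>, \<open>p\<close>, \<open>q\<close>, \<open>x\<close>
          is an induced path.\<close>
        ultimately obtain s where s: "r \<frown> s" "\<not> q \<frown> s"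
          using not_subset[of q r] r(2) by (auto simp: N_def)
        have "r \<frown> p" "p \<frown> q" using 3 by (auto simp: N_def B_def)
        moreover have "\<not> r \<frown> x" using x by (auto simp: N_def B_def)
        moreover have "\<not> s \<frown> x" using x s by (auto simp: N_def B_def)
        ultimately show False
          using P5_free[of s r p q x] s qx adj_sym by blast
      qed
    qed (use qx in \<open>auto simp: N_def B_def\<close>)
  qed simp
  then have A_nbr: "\<exists>b. r \<frown> b \<and> b \<frown> v" if "v \<in> A" "v \<noteq> r" for v
    using that by (auto simp: A_def B_def N_def)
  have rB: "r \<frown> v \<longleftrightarrow> v \<in> B" for v by (simp add: B_def N_def)
  have AB: "A \<inter> B = {}" "A \<union> B = pverts G" using NV by (auto simp: A_def B_def)
  \<comment> \<open>An edge inside \<open>A\<close> would close a walk of length 5 through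
    \<open>r\<close> and two vertices of \<open>B\<close>.\<close>
  have stableA: "\<not> u \<frown> v" if "u \<in> A" "v \<in> A" for u v
  proof
    assume uv: "u \<frown> v"
    then have "u \<noteq> r" "v \<noteq> r" using that rB AB adj_commute by blast+
    then obtain b b' where "r \<frown> b" "b \<frown> u" "r \<frown> b'" "b' \<frown> v" using A_nbr \<open>u \<in> A\<close> \<open>v \<in> A\<close> by blast
    then show False using pentagon_free[of r b u v b'] uv adj_sym by blast
  qed
  \<comment> \<open>Two independent edges across would form a \<open>P5\<close> with middle vertex
    \<open>r\<close>.\<close>
  have no_2K2: "a \<frown> b' \<or> a' \<frown> b" if "a \<in> A" "a' \<in> A" "b \<in> B" "b' \<in> B" "a \<frown> b" "a' \<frown> b'" for a a' b b'
  proof (rule ccontr)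
    assume no: "\<not> (a \<frown> b' \<or> a' \<frown> b)"
    have "\<not> a \<frown> a'" using that stableA by blast
    then show False using P5_free[of a b r b' a'] no that rB adj_sym by blast
  qed
  have "B \<noteq> {}"
  proof
    assume "B = {}"
    then have "card (N w) = 0" if "w \<in> pverts G" for w using r(2)[OF that] by (simp add: B_def)
    then have "N w = {}" if "w \<in> pverts G" for w using that finN by simp
    moreover obtain u v where "u \<frown> v" using has_arc by auto
    ultimately show False using in_arcsD1 by (fastforce simp: N_def)
  qed
  then obtain b0 where b0: "b0 \<in> B" "\<And>b. b \<in> B \<Longrightarrow> card (N b) \<le> card (N b0)" using max[of B] finN by (auto simp: B_def)
  \<comment> \<open>If \<open>b0\<close> missed \<open>a\<close>, a neighbour \<open>b\<close> of
    \<open>a\<close> in \<open>B\<close> would miss some neighbour \<open>a'\<close> of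
    \<open>b0\<close>, giving two independent edges.\<close>
  have b0A: "a \<frown> b0" if a: "a \<in> A" for a
  proof (rule ccontr)
    assume no: "\<not> a \<frown> b0"
    then have "a \<noteq> r" using b0(1) rB by blast
    then obtain b where b: "b \<in> B" "b \<frown> a" using A_nbr[OF a] rB by blast
    then have "a \<in> N b" "a \<notin> N b0" using no adj_sym by (auto simp: N_def)
    then obtain a' where a': "b0 \<frown> a'" "\<not> b \<frown> a'"
      using not_subset[of b b0] b0(2)[OF b(1)] by (auto simp: N_def)
    have "a' \<in> A" using a'(1) b0(1) stableB AB in_arcsD2 by blast
    then show False using no_2K2[of a a' b b0] a b b0(1) a' no adj_sym by blast
  qed
  define A0 where "A0 = {a \<in> A. \<forall>b\<in>B. a \<frown> b}"
  define B0 where "B0 = {b \<in> B. \<forall>a\<in>A. a \<frown> b}"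
  have r0: "r \<in> A0" and b00: "b0 \<in> B0" using rA rB b0 b0A by (auto simp: A0_def B0_def)
  \<comment> \<open>An edge here, with a vertex missed by each of its ends, extends by
    \<open>r\<close> and \<open>b0\<close> to the half graph \<open>G6_9\<close>.\<close>
  have no11: "\<not> a \<frown> b" if a: "a \<in> A - A0" and b: "b \<in> B - B0" for a b
  proof
    assume ab: "a \<frown> b"
    obtain b' where b': "b' \<in> B" "\<not> a \<frown> b'" using a by (auto simp: A0_def)
    obtain a' where a': "a' \<in> A" "\<not> a' \<frown> b" using b by (auto simp: B0_def)
    have "\<not> a' \<frown> b'" using no_2K2[of a a' b b'] a b a' b' ab by blast
    then show False
      using G6_9_free[of r b0 b b' a a'] a b rB b0A a' b' b0(1) ab adj_sym by blast
  qed
  have arcs: "a \<frown> b \<longleftrightarrow> a \<in> A0 \<or> b \<in> B0" if "a \<in> A" "b \<in> B" for a b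
    using that no11 by (auto simp: A0_def B0_def)
  then have arcs': "b \<frown> a \<longleftrightarrow> b \<in> B0 \<or> a \<in> A0" if "a \<in> A" "b \<in> B" for a b
    using that adj_commute by blast
  have sub: "A0 \<subseteq> A" "B0 \<subseteq> B" by (auto simp: A0_def B0_def)
  then have un: "A0 \<union> (A - A0) = A" "B0 \<union> (B - B0) = B" by auto
  have fin: "finite A" "finite B" using AB(2) finite_verts by (metis finite_Un)+
  \<comment> \<open>Otherwise the edge \<open>b0\<close>, \<open>r\<close> carries two leaves at
    each end, which is \<open>G6_1\<close>.\<close>
  have "card (A - A0) \<le> 1 \<or> card (B - B0) \<le> 1"
  proof (rule ccontr)
    assume "\<not> ?thesis"
    then obtain a a' b b' where ab: "a \<in> A - A0" "a' \<in> A - A0" "a \<noteq> a'" "b \<in> B - B0"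
      "b' \<in> B - B0" "b \<noteq> b'"
      using fin by (auto simp: card_le_Suc0_iff_eq)
    then have "r \<frown> b" "r \<frown> b'" "b0 \<frown> a" "b0 \<frown> a'" "r \<frown> b0" using rB b0A b0(1) adj_sym by auto
    then show False using G6_1_free[of b0 r a a' b b'] ab no11 adj_sym by blast
  qed
  then show ?thesis
  proof
    assume "card (B - B0) \<le> 1"
    then show ?thesis
      using AB stableA stableB arcs b00
      by (intro colouring_of_four_classes[of A0 "A - A0" B0 "B - B0"], unfold un) auto
  next
    \<comment> \<open>The two sides exchange roles, and \<open>r\<close> witnesses that
      \<open>A0\<close> is nonempty.\<close>
    assume "card (A - A0) \<le> 1"
    then show ?thesis
      using AB stableA stableB arcs' r0
      by (intro colouring_of_four_classes[of B0 "B - B0" A0 "A - A0"], unfold un) auto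
  qed
qed

lemma has_C5_colouring: "\<exists>\<phi>. C5_colouring \<phi> G"
proof (cases "\<exists>a b c d e. a \<frown> b \<and> b \<frown> c \<and> c \<frown> d \<and> d \<frown> e \<and> e \<frown> a")
  case True
  then obtain a b c d e where cyc: "a \<frown> b" "b \<frown> c" "c \<frown> d" "d \<frown> e" "e \<frown> a" by blast
  define f where "f i = [a, b, c, d, e] ! (i mod 5)" for i :: nat
  have "f i \<frown> f (i + 1)" for i
  proof -
    have "i mod 5 < 5" by simp
    then consider "i mod 5 = 0" | "i mod 5 = 1" | "i mod 5 = 2" | "i mod 5 = 3" | "i mod 5 = 4"
      by linarith
    then show ?thesis using cyc by cases (simp_all add: f_def mod_Suc)
  qed
  then show ?thesis by (intro colouring_around_pentagon[of f]) (simp_all add: f_def)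
next
  case False
  then show ?thesis by (intro colouring_of_pentagon_free) blast
qed

end

section \<open>Assembling both directions\<close>

lemma pair_wf_F3: "H \<in> F3 \<Longrightarrow> pair_wf_digraph H"
  unfolding F3_def by (elim insertE emptyE; simp only: pair_wf_clone_graph)

text \<open>A colouring would carry a triangle into \<open>C5\<close>, which has none; this leaves
  the four triangle-free members.\<close>

lemma F3_not_C5_colourable:
  assumes "H \<in> F3"
  shows "\<not> C5_colouring \<phi> H"
proof
  assume \<phi>: "C5_colouring \<phi> H"
  then have "\<not> has_triangle H"
    using has_triangle_induced_hom[OF _ pair_wf_F3[OF assms]] C5_triangle_free
    by (auto simp: C5_colouring_def)
  then have "H \<in> {P5, G6_1, G6_3, G6_9}" by (rule F3_triangle_free_members[OF assms])
  then show False
    using \<phi> P5_not_C5_colourable G6_1_not_C5_colourable G6_3_not_C5_colourable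
      G6_9_not_C5_colourable by blast
qed

lemma (in pair_graph) clique_number_2D:
  assumes "clique_number G = 2"
  shows "parcs G \<noteq> {}" "\<not> has_triangle G"
proof -
  let ?C = "{card S | S. S \<subseteq> pverts G \<and> (\<forall>u\<in>S. \<forall>v\<in>S. u \<noteq> v \<longrightarrow> (u, v) \<in> parcs G)}"
  have "?C \<subseteq> card ` Pow (pverts G)" by blast
  then have fin: "finite ?C" by (rule finite_subset) simp
  \<comment> \<open>The empty clique makes the set of sizes nonempty, so the maximum is
    attained.\<close>
  have "0 \<in> ?C" by (intro CollectI exI[of _ "{}"]) simp
  then have "2 \<in> ?C" using Max_in[OF fin] assms unfolding clique_number_def by auto
  then obtain S where "card S = 2" "\<forall>u\<in>S. \<forall>v\<in>S. u \<noteq> v \<longrightarrow> (u, v) \<in> parcs G" by auto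
  then show "parcs G \<noteq> {}" by (auto simp: card_2_iff)
  show "\<not> has_triangle G"
  proof
    assume "has_triangle G"
    then obtain u v w where uvw: "(u, v) \<in> parcs G" "(v, w) \<in> parcs G" "(u, w) \<in> parcs G"
      by (auto simp: has_triangle_def)
    then have "(v, u) \<in> parcs G" "(w, v) \<in> parcs G" "(w, u) \<in> parcs G"
      using sym_arcs by (auto simp: symmetric_def dest: symD)
    moreover have "u \<noteq> v" "v \<noteq> w" "u \<noteq> w" using uvw no_loops by fastforce+
    moreover have "{u, v, w} \<subseteq> pverts G" using uvw in_arcsD1 in_arcsD2 by blast
    ultimately have "3 \<in> ?C" using uvw by (intro CollectI exI[of _ "{u, v, w}"]) auto
    then have "3 \<le> clique_number G" unfolding clique_number_def by (rule Max_ge[OF fin])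
    then show False using assms by simp
  qed
qed

text \<open>Connectedness means strong connectedness of the symmetric closure; as \<open>G\<close>
  is symmetric, its own arcs already reach every vertex, and they never leave
  \<open>S\<close>.\<close>

lemma (in pair_graph) connected_closed_set:
  assumes "Digraph_Component.connected (with_proj G)" "S \<subseteq> pverts G" "S \<noteq> {}"
    and closed: "\<And>u v. u \<in> S \<Longrightarrow> (u, v) \<in> parcs G \<Longrightarrow> v \<in> S"
  shows "S = pverts G"
proof
  obtain u where u: "u \<in> S" using assms(3) by blast
  show "pverts G \<subseteq> S"
  proof
    fix v assume "v \<in> pverts G"
    then have "u \<rightarrow>\<^sup>*\<^bsub>with_proj (mk_symmetric (with_proj G))\<^esub> v"
      using assms(1,2) u unfolding Digraph_Component.connected_def strongly_connected_def by auto
    then have "u \<rightarrow>\<^sup>*\<^bsub>with_proj G\<^esub> v" using reachable_mk_symmetric_eq sym_arcs by blast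
    then show "v \<in> S"
      by (rule reachable_induct) (use u closed in auto)
  qed
qed fact

theorem theorem3p3:
  fixes G :: "'a pair_pre_digraph"
  assumes "pair_graph G"
    and "Digraph_Component.connected (with_proj G)"
    and "clique_number G = 2"
  shows "family_free F3 G \<longleftrightarrow> (\<exists>H\<in>F2. iso_to_induced_subgraph G H)"
proof -
  interpret pair_graph G by fact
  have wf: "pair_wf_digraph G" ..
  show ?thesis
    unfolding F2_iff_C5_colouring[OF wf finite_verts]
  proof
    assume free: "family_free F3 G"
    have members: "{P5, G6_1, G6_3, G6_9} \<subseteq> F3" unfolding F3_def by simp
    interpret triangle_free_graph G
      using clique_number_2D(2)[OF assms(3)] by unfold_locales (auto simp: has_triangle_def)
    have not_embedded: "\<not> iso_to_induced_subgraph P5 G" "\<not> iso_to_induced_subgraph G6_1 G"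
      "\<not> iso_to_induced_subgraph G6_3 G" "\<not> iso_to_induced_subgraph G6_9 G"
      using free members unfolding family_free_def by blast+
    \<comment> \<open>A violation of any of the four freeness rules would embed the corresponding
      member of \<open>F3\<close>.\<close>
    interpret P5_G6_free_graph G
    proof (unfold_locales, goal_cases)
      case (1 S) then show ?case using connected_closed_set[OF assms(2)] by blast
    next
      case 2 show ?case by (rule clique_number_2D(1)[OF assms(3)])
    next
      case (3 a b c d e) then show ?case using P5_embedding[of a b c d e] not_embedded(1) by blast
    next
      case (4 p q a a' b b')
      then show ?case using G6_1_embedding[of p q a a' b b'] not_embedded(2) by blast
    next
      case (5 x x' p q a a')
      then show ?case using G6_3_embedding[of x p q x' a a'] not_embedded(3) by blast
    next
      case (6 r s a a' b b')
      then show ?case using G6_9_embedding[of r s b b' a a'] not_embedded(4) by blast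
    qed
    show "\<exists>\<phi>. C5_colouring \<phi> G" by (rule has_C5_colouring)
  next
    assume "\<exists>\<phi>. C5_colouring \<phi> G"
    then obtain \<phi> where \<phi>: "C5_colouring \<phi> G" by blast
    show "family_free F3 G"
      unfolding family_free_def
    proof (intro ballI notI)
      fix H assume H: "H \<in> F3" and "iso_to_induced_subgraph H G"
      then obtain f where "inj_on f (pverts H)" "induced_hom f H G"
        using iso_to_induced_subgraph_iff[OF pair_wf_F3[OF H] wf] by blast
      \<comment> \<open>An induced copy of \<open>H\<close> inherits the colouring of
        \<open>G\<close>.\<close>
      then have "C5_colouring (\<phi> \<circ> f) H" using C5_colouring_comp[OF \<phi> finite_verts] by blast
      then show False using F3_not_C5_colourable[OF H] by blast
    qed
  qed
qed

end
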